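(* Let $G=(V,E)$ be a connected graph with $n$ vertices and maximum degree $\Delta$, let $k\in\{2,\dots,n-1\}$, let $\mathscr{S}$ be a $k$-block system for $G$ and let $\psi$ be the uniform distribution on $\mathscr{S}$. Fix $\lambda>1$. If $q\ge 2^{k+1}\Delta^{2k}k^{2k+1}\lambda^{\Delta-1+k^{-1}}$, then for every $\varepsilon>0$, $\tau(\mathcal{M}_{\mathrm{BD}}^{\mathscr{S},\psi}(G,\lambda,q),\varepsilon)\le 2n\log(n\varepsilon^{-1})$.
   Context: Potts model on $G$: configurations $\sigma\in\Omega=[q]^V$, $\mu(\sigma)$ = number of monochromatic edges, Gibbs distribution $\pi(\sigma)\propto\lambda^{\mu(\sigma)}$. $\tau(\mathcal{M},\varepsilon)=\max_x\min\{t:\|P^t(x,\cdot)-\pi\|_{TV}\le\varepsilon\}$. A $k$-block system for $G$ is a family $\mathscr{S}=\{S_v:v\in V\}$ with $v\in S_v$, $|S_v|=k$ and $G[S_v]$ connected. For $S\subseteq V$, $X\in\Omega$, $c\in[q]^S$: $X^{(S,c)}$ equals $c$ on $S$ and $X$ off $S$, and $\mu_{X,S}(c)$ is the number of monochromatic edges of $X^{(S,c)}$ incident with at least one vertex of $S$. The $(\mathscr{S},\psi)$-block dynamics $\mathcal{M}_{\mathrm{BD}}^{\mathscr{S},\psi}(G,\lambda,q)$ is the chain on $\Omega$ which from $X_t$ picks $S\in\mathscr{S}$ according to $\psi$, picks $c\in[q]^S$ with probability proportional to $\lambda^{\mu_{X_t,S}(c)}$, and moves to $X_t^{(S,c)}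$.
   Formalization: The formal theorem takes 0<ε<1 instead of every ε>0: for ε>n the claim fails (τ=0 but 2n log(n/ε)<0), and for 1≤ε≤n it is trivial since total variation is at most 1, so τ=0; the uniform ψ is read as choosing v∈V uniformly and updating S_v. *)

theory Defs
  imports Complex_Main
begin

definition simple_graph :: "'v set \<Rightarrow> ('v \<Rightarrow> 'v \<Rightarrow> bool) \<Rightarrow> bool" where
  "simple_graph V adj \<longleftrightarrow> finite V \<and> (\<forall>u v. adj u v \<longrightarrow> u \<in> V \<and> v \<in> V)
     \<and> (\<forall>u v. adj u v \<longrightarrow> adj v u) \<and> (\<forall>v. \<not> adj v v)"

definition induced_connected :: "('v \<Rightarrow> 'v \<Rightarrow> bool) \<Rightarrow> 'v set \<Rightarrow> bool" where
  "induced_connected adj S \<longleftrightarrow>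
     (\<forall>u\<in>S. \<forall>v\<in>S. (\<lambda>a b. a \<in> S \<and> b \<in> S \<and> adj a b)\<^sup>*\<^sup>* u v)"

definition connected_graph :: "'v set \<Rightarrow> ('v \<Rightarrow> 'v \<Rightarrow> bool) \<Rightarrow> bool" where
  "connected_graph V adj \<longleftrightarrow> induced_connected adj V"

definition degree :: "'v set \<Rightarrow> ('v \<Rightarrow> 'v \<Rightarrow> bool) \<Rightarrow> 'v \<Rightarrow> nat" where
  "degree V adj v = card {u \<in> V. adj v u}"

definition max_degree :: "'v set \<Rightarrow> ('v \<Rightarrow> 'v \<Rightarrow> bool) \<Rightarrow> nat" where
  "max_degree V adj = Max (degree V adj ` V)"

definition edges :: "'v set \<Rightarrow> ('v \<Rightarrow> 'v \<Rightarrow> bool) \<Rightarrow> 'v set set" where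
  "edges V adj = {{u, v} | u v. u \<in> V \<and> v \<in> V \<and> adj u v}"

definition block_system :: "'v set \<Rightarrow> ('v \<Rightarrow> 'v \<Rightarrow> bool) \<Rightarrow> nat \<Rightarrow> ('v \<Rightarrow> 'v set) \<Rightarrow> bool" where
  "block_system V adj k Sb \<longleftrightarrow>
     (\<forall>v\<in>V. v \<in> Sb v \<and> Sb v \<subseteq> V \<and> card (Sb v) = k \<and> induced_connected adj (Sb v))"

text \<open>Colours are [q] = {0..<q}; a configuration is a map V \<rightarrow> [q], represented
extensionally (value 0 outside V).\<close>
definition configs :: "'v set \<Rightarrow> nat \<Rightarrow> ('v \<Rightarrow> nat) set" where
  "configs V q = {\<sigma>. (\<forall>v\<in>V. \<sigma> v < q) \<and> (\<forall>v. v \<notin> V \<longrightarrow> \<sigma> v = 0)}"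

definition mono_edges :: "'v set \<Rightarrow> ('v \<Rightarrow> 'v \<Rightarrow> bool) \<Rightarrow> ('v \<Rightarrow> nat) \<Rightarrow> 'v set set" where
  "mono_edges V adj \<sigma> = {e \<in> edges V adj. \<exists>u v. e = {u, v} \<and> \<sigma> u = \<sigma> v}"

definition mu :: "'v set \<Rightarrow> ('v \<Rightarrow> 'v \<Rightarrow> bool) \<Rightarrow> ('v \<Rightarrow> nat) \<Rightarrow> nat" where
  "mu V adj \<sigma> = card (mono_edges V adj \<sigma>)"

definition gibbs :: "'v set \<Rightarrow> ('v \<Rightarrow> 'v \<Rightarrow> bool) \<Rightarrow> nat \<Rightarrow> real \<Rightarrow> ('v \<Rightarrow> nat) \<Rightarrow> real" where
  "gibbs V adj q lam \<sigma> =
     lam ^ mu V adj \<sigma> / (\<Sum>\<tau>\<in>configs V q. lam ^ mu V adj \<tau>)"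

definition block_colourings :: "'v set \<Rightarrow> nat \<Rightarrow> ('v \<Rightarrow> nat) set" where
  "block_colourings S q = {c. (\<forall>v\<in>S. c v < q) \<and> (\<forall>v. v \<notin> S \<longrightarrow> c v = 0)}"

definition upd_block :: "('v \<Rightarrow> nat) \<Rightarrow> 'v set \<Rightarrow> ('v \<Rightarrow> nat) \<Rightarrow> ('v \<Rightarrow> nat)" where
  "upd_block X S c = (\<lambda>v. if v \<in> S then c v else X v)"

definition mu_block :: "'v set \<Rightarrow> ('v \<Rightarrow> 'v \<Rightarrow> bool) \<Rightarrow> ('v \<Rightarrow> nat) \<Rightarrow> 'v set \<Rightarrow> ('v \<Rightarrow> nat) \<Rightarrow> nat" where
  "mu_block V adj X S c = card {e \<in> mono_edges V adj (upd_block X S c). e \<inter> S \<noteq> {}}"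

definition block_step :: "'v set \<Rightarrow> ('v \<Rightarrow> 'v \<Rightarrow> bool) \<Rightarrow> nat \<Rightarrow> real \<Rightarrow> 'v set
    \<Rightarrow> ('v \<Rightarrow> nat) \<Rightarrow> ('v \<Rightarrow> nat) \<Rightarrow> real" where
  "block_step V adj q lam S X Y =
     (\<Sum>c\<in>{c \<in> block_colourings S q. upd_block X S c = Y}. lam ^ mu_block V adj X S c)
     / (\<Sum>c\<in>block_colourings S q. lam ^ mu_block V adj X S c)"

text \<open>(S,psi)-block dynamics with psi uniform over the family {S_v : v in V}.\<close>
definition block_dynamics :: "'v set \<Rightarrow> ('v \<Rightarrow> 'v \<Rightarrow> bool) \<Rightarrow> nat \<Rightarrow> real \<Rightarrow> ('v \<Rightarrow> 'v set)
    \<Rightarrow> ('v \<Rightarrow> nat) \<Rightarrow> ('v \<Rightarrow> nat) \<Rightarrow> real" where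
  "block_dynamics V adj q lam Sb X Y =
     (\<Sum>v\<in>V. block_step V adj q lam (Sb v) X Y) / real (card V)"

fun mpow :: "'s set \<Rightarrow> ('s \<Rightarrow> 's \<Rightarrow> real) \<Rightarrow> nat \<Rightarrow> 's \<Rightarrow> 's \<Rightarrow> real" where
  "mpow \<Omega> P 0 x y = (if x = y then 1 else 0)"
| "mpow \<Omega> P (Suc t) x y = (\<Sum>z\<in>\<Omega>. mpow \<Omega> P t x z * P z y)"

definition tv_dist :: "'s set \<Rightarrow> ('s \<Rightarrow> real) \<Rightarrow> ('s \<Rightarrow> real) \<Rightarrow> real" where
  "tv_dist \<Omega> p r = (\<Sum>y\<in>\<Omega>. \<bar>p y - r y\<bar>) / 2"

definition mixing_time :: "'s set \<Rightarrow> ('s \<Rightarrow> 's \<Rightarrow> real) \<Rightarrow> ('s \<Rightarrow> real) \<Rightarrow> real \<Rightarrow> nat" where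
  "mixing_time \<Omega> P \<pi> \<epsilon> =
     Max ((\<lambda>x. LEAST t. tv_dist \<Omega> (mpow \<Omega> P t x) \<pi> \<le> \<epsilon>) ` \<Omega>)"

end

theory Submission
  imports Defs "HOL-Library.FuncSet"
begin

text \<open>Path coupling in dual form: one step of the chain shrinks the Lipschitz constant (for the
  Hamming distance) of every function by the factor \<open>1 - 3 / (4 n)\<close>, and total variation is a
  supremum over functions with Lipschitz constant \<open>1\<close>.

  Let two configurations differ only at \<open>v\<close>. An update of a block containing \<open>v\<close> (there is at
  least one) removes the discrepancy, and an update of a block not adjacent to \<open>v\<close> keeps it. For
  a block \<open>S\<close> adjacent to \<open>v\<close> the two update distributions differ only on colourings giving a
  neighbour \<open>w \<in> S\<close> of \<open>v\<close> one of the two colours of \<open>v\<close>. If \<open>C\<close> is the monochromatic component of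
  such a \<open>w\<close> in \<open>S\<close>, then at most \<open>|C| (\<Delta> - 1)\<close> monochromatic edges touch \<open>C\<close>, or
  \<open>k (\<Delta> - 1) + 1\<close> if \<open>C = S\<close>; comparing with a free recolouring of \<open>C\<close>, this component has
  probability at most \<open>\<rho>\<^bsup>|C|\<^esup>\<close> with \<open>\<rho> = \<lambda>\<^bsup>\<Delta> - 1 + 1/k\<^esup> / q\<close>. As at most \<open>(1 + \<Delta>)\<^bsup>k\<^esup>\<close> blocks
  are adjacent to \<open>v\<close>, the bound on \<open>q\<close> makes the expected number of new discrepancies,
  summed over all blocks, at most \<open>1/4\<close>.\<close>

section \<open>Total variation distance of finite distributions\<close>

lemma tv_dist_commute: "tv_dist A p r = tv_dist A r p"
  by (simp add: tv_dist_def abs_minus_commute)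

lemma tv_dist_eq_sum_positive_part:
  assumes "sum p A = sum r A"
  shows "tv_dist A p r = (\<Sum>c\<in>A. max 0 (p c - r c))"
proof -
  have "(\<Sum>c\<in>A. max 0 (p c - r c)) = (\<Sum>c\<in>A. (\<bar>p c - r c\<bar> + (p c - r c)) / 2)"
    by (rule sum.cong) (auto simp: max_def)
  also have "\<dots> = tv_dist A p r + (sum p A - sum r A) / 2"
    by (simp add: tv_dist_def sum.distrib sum_subtractf flip: sum_divide_distrib)
  finally show ?thesis using assms by simp
qed

lemma tv_dist_leI:
  assumes "\<And>f. (\<And>z. \<bar>f z\<bar> \<le> 1 / 2) \<Longrightarrow> (\<Sum>z\<in>A. p z * f z) - (\<Sum>z\<in>A. r z * f z) \<le> R"
  shows "tv_dist A p r \<le> R"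
proof -
  define f where "f z = sgn (p z - r z) / 2" for z
  have "tv_dist A p r = (\<Sum>z\<in>A. (p z - r z) * f z)"
    unfolding tv_dist_def f_def sum_divide_distrib by (rule sum.cong) (simp_all add: abs_sgn)
  also have "\<dots> = (\<Sum>z\<in>A. p z * f z) - (\<Sum>z\<in>A. r z * f z)"
    by (simp add: left_diff_distrib sum_subtractf)
  also have "\<dots> \<le> R"
    by (rule assms) (auto simp: f_def sgn_if)
  finally show ?thesis .
qed

lemma sum_diff_le_oscillation_times_tv_dist:
  fixes g :: "'a \<Rightarrow> real"
  assumes fin: "finite A" and mass: "sum p A = sum r A"
    and osc: "\<And>c d. \<lbrakk>c \<in> A; d \<in> A\<rbrakk> \<Longrightarrow> g c - g d \<le> M"
  shows "(\<Sum>c\<in>A. p c * g c) - (\<Sum>c\<in>A. r c * g c) \<le> M * tv_dist A p r"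
proof (cases "A = {}")
  case False
  define m where "m = Min (g ` A) + M / 2"
  have near: "\<bar>g c - m\<bar> \<le> M / 2" if "c \<in> A" for c
  proof -
    have "Min (g ` A) \<in> g ` A" using fin False by (intro Min_in) auto
    then obtain d where d: "d \<in> A" "Min (g ` A) = g d" by (rule imageE)
    have "Min (g ` A) \<le> g c" using fin that by simp
    then show ?thesis using osc[OF that d(1)] d(2) unfolding m_def by (simp add: abs_le_iff field_simps)
  qed
  have "(\<Sum>c\<in>A. p c * g c) - (\<Sum>c\<in>A. r c * g c) = (\<Sum>c\<in>A. (p c - r c) * (g c - m)) + (sum p A - sum r A) * m"
    by (simp add: algebra_simps sum.distrib sum_subtractf sum_distrib_left)
  also have "\<dots> = (\<Sum>c\<in>A. (p c - r c) * (g c - m))" using mass by simp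
  also have "\<dots> \<le> (\<Sum>c\<in>A. \<bar>p c - r c\<bar> * (M / 2))"
  proof (rule sum_mono)
    fix c assume "c \<in> A"
    then show "(p c - r c) * (g c - m) \<le> \<bar>p c - r c\<bar> * (M / 2)"
      using mult_left_mono[OF near, of c "\<bar>p c - r c\<bar>"] abs_ge_self[of "(p c - r c) * (g c - m)"]
      by (simp add: abs_mult)
  qed
  also have "\<dots> = M * tv_dist A p r"
    by (simp add: tv_dist_def sum_distrib_left sum_divide_distrib mult_ac)
  finally show ?thesis .
qed (simp add: tv_dist_def)

lemma tv_dist_mixture_le:
  assumes "sum \<pi> Y = 1" "\<And>y. y \<in> Y \<Longrightarrow> 0 \<le> \<pi> y" "\<And>y. y \<in> Y \<Longrightarrow> tv_dist A p (r y) \<le> R"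
  shows "tv_dist A p (\<lambda>z. \<Sum>y\<in>Y. \<pi> y * r y z) \<le> R"
proof -
  have "tv_dist A p (\<lambda>z. \<Sum>y\<in>Y. \<pi> y * r y z) = (\<Sum>z\<in>A. \<bar>\<Sum>y\<in>Y. \<pi> y * (p z - r y z)\<bar>) / 2"
    using assms(1)
    by (simp add: tv_dist_def right_diff_distrib sum_subtractf flip: sum_distrib_right)
  also have "\<dots> \<le> (\<Sum>z\<in>A. \<Sum>y\<in>Y. \<pi> y * \<bar>p z - r y z\<bar>) / 2"
  proof (intro divide_right_mono sum_mono)
    fix z
    have "\<bar>\<Sum>y\<in>Y. \<pi> y * (p z - r y z)\<bar> \<le> (\<Sum>y\<in>Y. \<bar>\<pi> y * (p z - r y z)\<bar>)" by (rule sum_abs)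
    also have "\<dots> = (\<Sum>y\<in>Y. \<pi> y * \<bar>p z - r y z\<bar>)"
      using assms(2) by (intro sum.cong) (auto simp: abs_mult)
    finally show "\<bar>\<Sum>y\<in>Y. \<pi> y * (p z - r y z)\<bar> \<le> (\<Sum>y\<in>Y. \<pi> y * \<bar>p z - r y z\<bar>)" .
  qed simp
  also have "\<dots> = (\<Sum>y\<in>Y. \<pi> y * tv_dist A p (r y))"
    by (subst sum.swap) (simp add: tv_dist_def sum_distrib_left sum_divide_distrib)
  also have "\<dots> \<le> (\<Sum>y\<in>Y. \<pi> y * R)" using assms by (intro sum_mono mult_left_mono)
  also have "\<dots> = R" using assms(1) by (simp flip: sum_distrib_right)
  finally show ?thesis .
qed

definition normalise :: "'a set \<Rightarrow> ('a \<Rightarrow> real) \<Rightarrow> 'a \<Rightarrow> real" where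
  "normalise A w c = w c / sum w A"

lemma normalise_nonneg: "(\<And>c. c \<in> A \<Longrightarrow> 0 \<le> w c) \<Longrightarrow> c \<in> A \<Longrightarrow> 0 \<le> normalise A w c"
  by (simp add: normalise_def sum_nonneg)

lemma sum_normalise: "sum w A \<noteq> 0 \<Longrightarrow> sum (normalise A w) A = 1"
  by (simp add: normalise_def flip: sum_divide_distrib)

text \<open>Where the weights agree, the one with the larger total is the smaller one after normalisation,
  so only its mass on the exceptional event contributes.\<close>
lemma tv_dist_normalise_le_mass_of_larger:
  assumes fin: "finite A"
    and u: "\<And>c. c \<in> A \<Longrightarrow> 0 \<le> u c" and w: "\<And>c. c \<in> A \<Longrightarrow> 0 \<le> w c"
    and total: "0 < sum w A" "sum w A \<le> sum u A"
    and agree: "\<And>c. \<lbrakk>c \<in> A; \<not> E c\<rbrakk> \<Longrightarrow> u c = w c"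
  shows "tv_dist A (normalise A u) (normalise A w) \<le> (\<Sum>c | c \<in> A \<and> E c. normalise A u c)"
proof -
  have "tv_dist A (normalise A u) (normalise A w)
      = (\<Sum>c\<in>A. max 0 (normalise A u c - normalise A w c))"
    using total by (intro tv_dist_eq_sum_positive_part) (simp add: sum_normalise)
  also have "\<dots> \<le> (\<Sum>c\<in>A. if E c then normalise A u c else 0)"
  proof (rule sum_mono)
    fix c assume c: "c \<in> A"
    have "normalise A u c \<le> normalise A w c" if "\<not> E c"
      unfolding normalise_def agree[OF c that] using w[OF c] total by (intro frac_le) auto
    then show "max 0 (normalise A u c - normalise A w c) \<le> (if E c then normalise A u c else 0)"
      using normalise_nonneg[of A u c] normalise_nonneg[of A w c] u w c by auto
  qed
  also have "\<dots> = (\<Sum>c | c \<in> A \<and> E c. normalise A u c)"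
    using fin by (simp add: sum.inter_filter)
  finally show ?thesis .
qed

lemma tv_dist_normalise_le:
  assumes fin: "finite A"
    and u: "\<And>c. c \<in> A \<Longrightarrow> 0 \<le> u c" "0 < sum u A" and w: "\<And>c. c \<in> A \<Longrightarrow> 0 \<le> w c" "0 < sum w A"
    and agree: "\<And>c. \<lbrakk>c \<in> A; \<not> E c\<rbrakk> \<Longrightarrow> u c = w c"
    and mass: "(\<Sum>c | c \<in> A \<and> E c. normalise A u c) \<le> \<beta>" "(\<Sum>c | c \<in> A \<and> E c. normalise A w c) \<le> \<beta>"
  shows "tv_dist A (normalise A u) (normalise A w) \<le> \<beta>"
proof (cases "sum w A \<le> sum u A")
  case True
  have "tv_dist A (normalise A u) (normalise A w) \<le> (\<Sum>c | c \<in> A \<and> E c. normalise A u c)"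
    by (rule tv_dist_normalise_le_mass_of_larger[OF fin u(1) w True agree])
  then show ?thesis using mass(1) by linarith
next
  case False
  then have "tv_dist A (normalise A w) (normalise A u) \<le> (\<Sum>c | c \<in> A \<and> E c. normalise A w c)"
    by (intro tv_dist_normalise_le_mass_of_larger fin w u) (auto simp: agree)
  then show ?thesis
    using mass(2) tv_dist_commute[of A "normalise A u" "normalise A w"] by linarith
qed

section \<open>Lipschitz contraction of finite Markov chains\<close>

definition kernel_apply :: "'s set \<Rightarrow> ('s \<Rightarrow> 's \<Rightarrow> real) \<Rightarrow> ('s \<Rightarrow> real) \<Rightarrow> 's \<Rightarrow> real" where
  "kernel_apply \<Omega> P f x = (\<Sum>y\<in>\<Omega>. P x y * f y)"

lemma kernel_apply_mpow_0: "\<lbrakk>finite \<Omega>; x \<in> \<Omega>\<rbrakk> \<Longrightarrow> kernel_apply \<Omega> (mpow \<Omega> P 0) f x = f x"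
  by (simp add: kernel_apply_def if_distrib[of "\<lambda>a. a * _"] cong: if_cong)

lemma kernel_apply_mpow_Suc:
  "kernel_apply \<Omega> (mpow \<Omega> P (Suc t)) f = kernel_apply \<Omega> (mpow \<Omega> P t) (kernel_apply \<Omega> P f)"
proof
  fix x
  show "kernel_apply \<Omega> (mpow \<Omega> P (Suc t)) f x = kernel_apply \<Omega> (mpow \<Omega> P t) (kernel_apply \<Omega> P f) x"
    unfolding kernel_apply_def mpow.simps sum_distrib_left sum_distrib_right mult.assoc[symmetric]
    by (rule sum.swap)
qed

definition stationary :: "'s set \<Rightarrow> ('s \<Rightarrow> 's \<Rightarrow> real) \<Rightarrow> ('s \<Rightarrow> real) \<Rightarrow> bool" where
  "stationary \<Omega> P \<pi> \<longleftrightarrow> (\<forall>y\<in>\<Omega>. (\<Sum>x\<in>\<Omega>. \<pi> x * P x y) = \<pi> y)"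

lemma detailed_balance_stationary:
  assumes "\<And>x y. \<lbrakk>x \<in> \<Omega>; y \<in> \<Omega>\<rbrakk> \<Longrightarrow> \<pi> x * P x y = \<pi> y * P y x"
    and "\<And>x. x \<in> \<Omega> \<Longrightarrow> sum (P x) \<Omega> = 1"
  shows "stationary \<Omega> P \<pi>"
  unfolding stationary_def
proof
  fix y assume y: "y \<in> \<Omega>"
  have "(\<Sum>x\<in>\<Omega>. \<pi> x * P x y) = (\<Sum>x\<in>\<Omega>. \<pi> y * P y x)" using assms(1) y by (intro sum.cong) auto
  also have "\<dots> = \<pi> y" using assms(2)[OF y] by (simp flip: sum_distrib_left)
  finally show "(\<Sum>x\<in>\<Omega>. \<pi> x * P x y) = \<pi> y" .
qed

lemma stationary_mpow:
  assumes "finite \<Omega>" "stationary \<Omega> P \<pi>"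
  shows "stationary \<Omega> (mpow \<Omega> P t) \<pi>"
proof (induction t)
  case 0
  then show ?case using assms(1) by (simp add: stationary_def if_distrib cong: if_cong)
next
  case (Suc t)
  have "(\<Sum>x\<in>\<Omega>. \<pi> x * mpow \<Omega> P (Suc t) x y) = (\<Sum>z\<in>\<Omega>. (\<Sum>x\<in>\<Omega>. \<pi> x * mpow \<Omega> P t x z) * P z y)" for y
    unfolding mpow.simps sum_distrib_left sum_distrib_right mult.assoc[symmetric] by (rule sum.swap)
  then show ?case using Suc assms(2) by (simp add: stationary_def)
qed

lemma tv_dist_stationary_le:
  assumes "stationary \<Omega> P \<pi>" "sum \<pi> \<Omega> = 1" "\<And>y. y \<in> \<Omega> \<Longrightarrow> 0 \<le> \<pi> y"
    and "\<And>y. y \<in> \<Omega> \<Longrightarrow> tv_dist \<Omega> p (P y) \<le> R"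
  shows "tv_dist \<Omega> p \<pi> \<le> R"
proof -
  have "tv_dist \<Omega> p \<pi> = tv_dist \<Omega> p (\<lambda>z. \<Sum>y\<in>\<Omega>. \<pi> y * P y z)"
    using assms(1) by (simp add: tv_dist_def stationary_def)
  also have "\<dots> \<le> R" using assms by (intro tv_dist_mixture_le)
  finally show ?thesis .
qed

definition lipschitz_wrt :: "'s set \<Rightarrow> ('s \<Rightarrow> 's \<Rightarrow> real) \<Rightarrow> real \<Rightarrow> ('s \<Rightarrow> real) \<Rightarrow> bool" where
  "lipschitz_wrt \<Omega> d L f \<longleftrightarrow> (\<forall>x\<in>\<Omega>. \<forall>y\<in>\<Omega>. f x - f y \<le> L * d x y)"

definition lipschitz_contraction :: "'s set \<Rightarrow> ('s \<Rightarrow> 's \<Rightarrow> real) \<Rightarrow> real \<Rightarrow> ('s \<Rightarrow> 's \<Rightarrow> real) \<Rightarrow> bool" where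
  "lipschitz_contraction \<Omega> d \<alpha> P \<longleftrightarrow>
     (\<forall>L f. 0 \<le> L \<and> lipschitz_wrt \<Omega> d L f \<longrightarrow> lipschitz_wrt \<Omega> d (\<alpha> * L) (kernel_apply \<Omega> P f))"

lemma lipschitz_contraction_mpow:
  assumes "finite \<Omega>" "0 \<le> \<alpha>" "lipschitz_contraction \<Omega> d \<alpha> P"
  shows "lipschitz_contraction \<Omega> d (\<alpha> ^ t) (mpow \<Omega> P t)"
proof (induction t)
  case 0
  then show ?case
    using assms(1)
    by (simp add: lipschitz_contraction_def lipschitz_wrt_def kernel_apply_mpow_0 del: mpow.simps)
next
  case (Suc t)
  show ?case
    unfolding lipschitz_contraction_def kernel_apply_mpow_Suc
  proof (intro allI impI)
    fix L f assume "0 \<le> L \<and> lipschitz_wrt \<Omega> d L f"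
    then have "0 \<le> \<alpha> * L \<and> lipschitz_wrt \<Omega> d (\<alpha> * L) (kernel_apply \<Omega> P f)"
      using assms unfolding lipschitz_contraction_def by simp
    then have "lipschitz_wrt \<Omega> d (\<alpha> ^ t * (\<alpha> * L)) (kernel_apply \<Omega> (mpow \<Omega> P t) (kernel_apply \<Omega> P f))"
      using Suc unfolding lipschitz_contraction_def by blast
    then show "lipschitz_wrt \<Omega> d (\<alpha> ^ Suc t * L) (kernel_apply \<Omega> (mpow \<Omega> P t) (kernel_apply \<Omega> P f))"
      by (simp add: mult_ac)
  qed
qed

lemma tv_dist_mpow_contraction_le:
  assumes fin: "finite \<Omega>" and contr: "lipschitz_contraction \<Omega> d \<alpha> P" "0 \<le> \<alpha>"
    and stat: "stationary \<Omega> P \<pi>" "sum \<pi> \<Omega> = 1" "\<And>y. y \<in> \<Omega> \<Longrightarrow> 0 \<le> \<pi> y"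
    and d: "\<And>x. x \<in> \<Omega> \<Longrightarrow> 0 \<le> d x x" "\<And>x y. \<lbrakk>x \<in> \<Omega>; y \<in> \<Omega>; x \<noteq> y\<rbrakk> \<Longrightarrow> 1 \<le> d x y"
      "\<And>x y. \<lbrakk>x \<in> \<Omega>; y \<in> \<Omega>\<rbrakk> \<Longrightarrow> d x y \<le> D"
    and x: "x \<in> \<Omega>"
  shows "tv_dist \<Omega> (mpow \<Omega> P t x) \<pi> \<le> D * \<alpha> ^ t"
proof (rule tv_dist_stationary_le[OF stationary_mpow[OF fin stat(1)] stat(2,3)])
  fix y assume y: "y \<in> \<Omega>"
  show "tv_dist \<Omega> (mpow \<Omega> P t x) (mpow \<Omega> P t y) \<le> D * \<alpha> ^ t"
  proof (rule tv_dist_leI)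
    fix f :: "'a \<Rightarrow> real" assume f: "\<And>z. \<bar>f z\<bar> \<le> 1 / 2"
    have "f a - f b \<le> d a b" if "a \<in> \<Omega>" "b \<in> \<Omega>" for a b
      using d(1)[OF that(1)] d(2)[OF that] f[of a] f[of b] by (cases "a = b") (auto simp: abs_le_iff)
    then have "lipschitz_wrt \<Omega> d 1 f" by (simp add: lipschitz_wrt_def)
    then have "lipschitz_wrt \<Omega> d (\<alpha> ^ t * 1) (kernel_apply \<Omega> (mpow \<Omega> P t) f)"
      using lipschitz_contraction_mpow[OF fin contr(2,1)]
      unfolding lipschitz_contraction_def by (metis zero_le_one)
    then have "kernel_apply \<Omega> (mpow \<Omega> P t) f x - kernel_apply \<Omega> (mpow \<Omega> P t) f y \<le> \<alpha> ^ t * d x y"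
      using x y by (simp add: lipschitz_wrt_def)
    also have "\<dots> \<le> D * \<alpha> ^ t"
      using mult_left_mono[OF d(3)[OF x y], of "\<alpha> ^ t"] contr(2) by (simp add: mult.commute)
    finally show "(\<Sum>z\<in>\<Omega>. mpow \<Omega> P t x z * f z) - (\<Sum>z\<in>\<Omega>. mpow \<Omega> P t y z * f z) \<le> D * \<alpha> ^ t"
      by (simp add: kernel_apply_def)
  qed
qed

lemma mixing_time_leI:
  assumes "finite \<Omega>" "\<Omega> \<noteq> {}" "\<And>x. x \<in> \<Omega> \<Longrightarrow> tv_dist \<Omega> (mpow \<Omega> P t x) \<pi> \<le> \<epsilon>"
  shows "mixing_time \<Omega> P \<pi> \<epsilon> \<le> t"
  unfolding mixing_time_def using assms by (subst Max_le_iff) (auto intro: Least_le)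

section \<open>Configurations agreeing off a set\<close>

definition agree_off :: "'v set \<Rightarrow> ('v \<Rightarrow> nat) \<Rightarrow> ('v \<Rightarrow> nat) \<Rightarrow> bool" where
  "agree_off T x y \<longleftrightarrow> (\<forall>u. u \<notin> T \<longrightarrow> x u = y u)"

lemma agree_off_commute: "agree_off T x y \<longleftrightarrow> agree_off T y x"
  by (auto simp: agree_off_def)

lemma upd_block_cong: "agree_off S x y \<Longrightarrow> upd_block x S = upd_block y S"
  by (auto simp: agree_off_def upd_block_def fun_eq_iff)

lemma agree_off_upd_block_colours: "agree_off S (upd_block x S c) (upd_block x S d)"
  by (simp add: agree_off_def upd_block_def)

lemma agree_off_upd_block: "agree_off T x y \<Longrightarrow> agree_off T (upd_block x S c) (upd_block y S c)"
  by (simp add: agree_off_def upd_block_def)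

lemma mono_edges_subset: "mono_edges V adj \<sigma> \<subseteq> edges V adj"
  by (simp add: mono_edges_def)

lemma mono_edges_cong:
  assumes "\<And>v. v \<in> e \<Longrightarrow> \<sigma> v = \<tau> v"
  shows "e \<in> mono_edges V adj \<sigma> \<longleftrightarrow> e \<in> mono_edges V adj \<tau>"
  by (simp add: mono_edges_def assms cong: conj_cong)

lemma doubleton_in_mono_edges_iff:
  "{a, b} \<in> mono_edges V adj \<sigma> \<longleftrightarrow> {a, b} \<in> edges V adj \<and> \<sigma> a = \<sigma> b"
  unfolding mono_edges_def by (auto simp: doubleton_eq_iff)

definition touching :: "'v set \<Rightarrow> 'v set set \<Rightarrow> 'v set set" where
  "touching C F = {e \<in> F. e \<inter> C \<noteq> {}}"

lemma mu_block_eq_card_touching: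
  "mu_block V adj X S c = card (touching S (mono_edges V adj (upd_block X S c)))"
  by (simp add: mu_block_def touching_def)

lemma mono_edges_minus_touching_cong:
  assumes "agree_off C \<sigma> \<tau>"
  shows "mono_edges V adj \<sigma> - touching C (mono_edges V adj \<sigma>)
    = mono_edges V adj \<tau> - touching C (mono_edges V adj \<tau>)"
proof -
  have "e \<in> mono_edges V adj \<sigma> \<longleftrightarrow> e \<in> mono_edges V adj \<tau>" if "e \<inter> C = {}" for e
    using assms that by (intro mono_edges_cong) (auto simp: agree_off_def)
  then show ?thesis by (auto simp: touching_def)
qed

definition hamming :: "'v set \<Rightarrow> ('v \<Rightarrow> nat) \<Rightarrow> ('v \<Rightarrow> nat) \<Rightarrow> real" where
  "hamming V x y = real (card {v \<in> V. x v \<noteq> y v})"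

lemma hamming_self: "hamming V x x = 0"
  by (simp add: hamming_def)

lemma hamming_ge_1:
  assumes "finite V" "x \<in> configs V q" "y \<in> configs V q" "x \<noteq> y"
  shows "1 \<le> hamming V x y"
proof -
  obtain v where "x v \<noteq> y v" using assms(4) by auto
  then have "v \<in> {v \<in> V. x v \<noteq> y v}" using assms(2,3) by (force simp: configs_def)
  then have "0 < card {v \<in> V. x v \<noteq> y v}" using assms(1) by (auto simp: card_gt_0_iff)
  then show ?thesis by (simp add: hamming_def)
qed

lemma hamming_le_card_agree_off:
  assumes "finite T" "agree_off T x y"
  shows "hamming V x y \<le> real (card T)"
  unfolding hamming_def using assms by (intro of_nat_mono card_mono) (auto simp: agree_off_def)

lemma hamming_le_card: "finite V \<Longrightarrow> hamming V x y \<le> real (card V)"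
  unfolding hamming_def by (intro of_nat_mono card_mono) auto

lemma lipschitz_hammingI:
  fixes f :: "('v \<Rightarrow> nat) \<Rightarrow> real"
  assumes fin: "finite V"
    and neighbours: "\<And>x y v. \<lbrakk>x \<in> configs V q; y \<in> configs V q; v \<in> V; agree_off {v} x y\<rbrakk> \<Longrightarrow> f x - f y \<le> L"
  shows "lipschitz_wrt (configs V q) (hamming V) L f"
proof -
  have "f x - f y \<le> L * real n"
    if "x \<in> configs V q" "y \<in> configs V q" "card {v \<in> V. x v \<noteq> y v} = n" for x y n
    using that
  proof (induction n arbitrary: x)
    case 0
    then have "{v \<in> V. x v \<noteq> y v} = {}" using fin by simp
    then have "x v = y v" for v using 0 by (cases "v \<in> V") (auto simp: configs_def)
    then have "x = y" by (rule ext)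
    then show ?case by simp
  next
    case (Suc n)
    then have "{v \<in> V. x v \<noteq> y v} \<noteq> {}" by (metis card.empty nat.distinct(1))
    then obtain v where v: "v \<in> V" "x v \<noteq> y v" by blast
    let ?z = "x(v := y v)"
    have z: "?z \<in> configs V q" using Suc.prems v by (auto simp: configs_def)
    have "{u \<in> V. ?z u \<noteq> y u} = {u \<in> V. x u \<noteq> y u} - {v}" by auto
    then have "card {u \<in> V. ?z u \<noteq> y u} = n" using Suc.prems(3) v fin by simp
    then have "f ?z - f y \<le> L * real n" by (rule Suc.IH[OF z Suc.prems(2)])
    moreover have "f x - f ?z \<le> L"
      by (rule neighbours[OF Suc.prems(1) z v(1)]) (simp add: agree_off_def)
    ultimately show ?case by (simp add: algebra_simps)
  qed
  then show ?thesis by (simp add: lipschitz_wrt_def hamming_def)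
qed

section \<open>Connected vertex sets\<close>

lemma rtranclp_crossing:
  assumes "R\<^sup>*\<^sup>* x y" "x \<in> T" "y \<notin> T"
  shows "\<exists>a\<in>T. \<exists>b. b \<notin> T \<and> R a b"
  using assms(1,3)
proof (induction rule: rtranclp_induct)
  case (step y z)
  then show ?case by (cases "y \<in> T") auto
qed (use assms(2) in simp)

lemma induced_connected_crossing:
  assumes "induced_connected adj C" "T \<noteq> {}" "T \<subset> C"
  shows "\<exists>a\<in>T. \<exists>b\<in>C - T. adj a b"
proof -
  obtain u v where uv: "u \<in> T" "v \<in> C" "v \<notin> T" "u \<in> C" using assms by blast
  then have "(\<lambda>a b. a \<in> C \<and> b \<in> C \<and> adj a b)\<^sup>*\<^sup>* u v"
    using assms(1) by (simp add: induced_connected_def)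
  from rtranclp_crossing[OF this uv(1,3)] show ?thesis by blast
qed

lemma induced_connectedI_crossing:
  assumes crossing: "\<And>T. \<lbrakk>T \<noteq> {}; T \<subset> C\<rbrakk> \<Longrightarrow> \<exists>a\<in>T. \<exists>b\<in>C - T. adj a b"
  shows "induced_connected adj C"
  unfolding induced_connected_def
proof (intro ballI)
  let ?R = "\<lambda>a b. a \<in> C \<and> b \<in> C \<and> adj a b"
  fix u v assume uv: "u \<in> C" "v \<in> C"
  define T where "T = {b \<in> C. ?R\<^sup>*\<^sup>* u b}"
  have "b \<in> T" if "a \<in> T" "b \<in> C" "adj a b" for a b
    using that rtranclp.rtrancl_into_rtrancl[of ?R u a b] by (simp add: T_def)
  then have "\<not> (\<exists>a\<in>T. \<exists>b\<in>C - T. adj a b)" by blast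
  moreover have "T \<noteq> {}" "T \<subseteq> C" using uv by (auto simp: T_def)
  ultimately have "T = C" using crossing by blast
  then show "?R\<^sup>*\<^sup>* u v" using uv by (auto simp: T_def)
qed

lemma induced_connected_induct [consumes 3, case_names singleton insert]:
  assumes "finite C" "induced_connected adj C" "w \<in> C"
    and single: "P {w}"
    and insert: "\<And>T a b. \<lbrakk>w \<in> T; T \<subset> C; P T; a \<in> T; b \<in> C - T; adj a b\<rbrakk> \<Longrightarrow> P (insert b T)"
  shows "P C"
proof -
  have "\<exists>T\<subseteq>C. w \<in> T \<and> card T = Suc m \<and> P T" if "m < card C" for m
    using that
  proof (induction m)
    case 0
    then show ?case using assms(3) single by (intro exI[of _ "{w}"]) auto
  next
    case (Suc m)
    then obtain T where T: "T \<subseteq> C" "w \<in> T" "card T = Suc m" "P T" by auto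
    then have "T \<subset> C" using Suc.prems by auto
    then obtain a b where ab: "a \<in> T" "b \<in> C - T" "adj a b"
      using induced_connected_crossing[OF assms(2), of T] T(2) by blast
    have "card (insert b T) = Suc (Suc m)"
      using T ab assms(1) finite_subset[of T C] by simp
    then show ?case
      using T ab insert[OF T(2) \<open>T \<subset> C\<close> T(4) ab] by (intro exI[of _ "insert b T"]) auto
  qed
  moreover obtain m where "card C = Suc m"
    using assms(1,3) by (metis card.remove)
  ultimately obtain T where "T \<subseteq> C" "card T = card C" "P T" by auto
  then show ?thesis using assms(1) card_subset_eq by blast
qed

lemma induced_connected_reachable:
  assumes "symp R" "\<And>a b. R a b \<Longrightarrow> adj a b"
  shows "induced_connected adj {u. R\<^sup>*\<^sup>* w u}"
  unfolding induced_connected_def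
proof (intro ballI)
  let ?C = "{u. R\<^sup>*\<^sup>* w u}"
  fix u v assume "u \<in> ?C" "v \<in> ?C"
  then have "R\<^sup>*\<^sup>* w u" "R\<^sup>*\<^sup>* u v"
    using sympD[OF symp_rtranclp[OF assms(1)], of w u] by (auto dest: rtranclp_trans[of R u w v])
  from this(2,1) show "(\<lambda>a b. a \<in> ?C \<and> b \<in> ?C \<and> adj a b)\<^sup>*\<^sup>* u v"
  proof (induction rule: rtranclp_induct)
    case (step y z)
    then have "y \<in> ?C" "z \<in> ?C" by auto
    then show ?case
      using step assms(2) by (intro rtranclp.rtrancl_into_rtrancl[OF step.IH]) auto
  qed simp
qed

lemma induced_connected_insert:
  assumes "symp adj" "induced_connected adj S" "z \<in> S" "adj v z"
  shows "induced_connected adj (insert v S)"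
proof (rule induced_connectedI_crossing)
  fix T assume T: "T \<noteq> {}" "T \<subset> insert v S"
  have zv: "adj z v" using assms(1,4) by (rule sympD)
  have T_sub: "T \<subseteq> insert v S" "T \<noteq> insert v S" using T by auto
  show "\<exists>a\<in>T. \<exists>b\<in>insert v S - T. adj a b"
  proof (cases "T \<inter> S = {}")
    case True
    then have "v \<in> T" "z \<notin> T" using T T_sub assms(3) by auto
    then show ?thesis using assms(3,4) by blast
  next
    case T_meets: False
    show ?thesis
    proof (cases "S \<subseteq> T")
      case True
      then have "v \<notin> T" "z \<in> T" using T_sub assms(3) by auto
      then show ?thesis using zv by blast
    next
      case False
      then have "T \<inter> S \<subset> S" by auto
      then have "\<exists>a\<in>T \<inter> S. \<exists>b\<in>S - T \<inter> S. adj a b"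
        by (rule induced_connected_crossing[OF assms(2) T_meets])
      then show ?thesis by blast
    qed
  qed
qed

definition closed_nbhd :: "('v \<Rightarrow> 'v \<Rightarrow> bool) \<Rightarrow> 'v set \<Rightarrow> 'v set" where
  "closed_nbhd adj A = A \<union> {b. \<exists>a\<in>A. adj a b}"

lemma induced_connected_subset_closed_nbhd_funpow:
  assumes "finite C" "induced_connected adj C" "v \<in> C"
  shows "C \<subseteq> (closed_nbhd adj ^^ (card C - 1)) {v}"
  using assms
proof (induction rule: induced_connected_induct)
  case (insert T a b)
  let ?N = "\<lambda>m. (closed_nbhd adj ^^ m) {v}"
  have "finite T" using insert.hyps assms(1) finite_subset by blast
  then have card: "card (insert b T) - 1 = Suc (card T - 1)"
    using insert.hyps card_gt_0_iff[of T] by auto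
  have "?N (Suc (card T - 1)) = closed_nbhd adj (?N (card T - 1))" by simp
  moreover have "insert b T \<subseteq> closed_nbhd adj (?N (card T - 1))"
    using insert unfolding closed_nbhd_def by blast
  ultimately show ?case unfolding card by simp
qed simp

locale finite_simple_graph =
  fixes V :: "'v set" and adj :: "'v \<Rightarrow> 'v \<Rightarrow> bool"
  assumes simple: "simple_graph V adj"
begin

abbreviation \<Delta> :: nat where
  "\<Delta> \<equiv> max_degree V adj"

lemma finite_V: "finite V" and symp_adj: "symp adj" and adj_in_V: "adj u v \<Longrightarrow> v \<in> V"
  using simple by (auto simp: simple_graph_def symp_def)

lemma finite_subset_V: "S \<subseteq> V \<Longrightarrow> finite S"
  by (rule finite_subset[OF _ finite_V])

lemma finite_edges: "finite (edges V adj)"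
  by (rule finite_subset[of _ "Pow V"]) (use finite_V in \<open>auto simp: edges_def\<close>)

lemma doubleton_in_edges_iff: "{a, b} \<in> edges V adj \<longleftrightarrow> adj a b"
  using simple unfolding edges_def simple_graph_def by (auto simp: doubleton_eq_iff)

lemma card_neighbours_le: "u \<in> V \<Longrightarrow> card {w \<in> V. adj u w} \<le> \<Delta>"
  unfolding max_degree_def degree_def[symmetric] using finite_V by (intro Max_ge) auto

lemma card_edges_at_le:
  assumes "u \<in> V"
  shows "card (touching {u} (edges V adj)) \<le> \<Delta>"
proof -
  have "touching {u} (edges V adj) \<subseteq> (\<lambda>w. {u, w}) ` {w \<in> V. adj u w}"
    using simple unfolding touching_def edges_def simple_graph_def by blast
  then have "card (touching {u} (edges V adj)) \<le> card {w \<in> V. adj u w}"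
    using finite_V by (intro surj_card_le) auto
  also have "\<dots> \<le> \<Delta>" by (rule card_neighbours_le[OF assms])
  finally show ?thesis .
qed

text \<open>Growing \<open>C\<close> vertex by vertex, each new vertex brings at most \<open>\<Delta> - 1\<close> new edges,
  because one of its edges already touches the part built so far.\<close>
lemma card_edges_touching_connected_le:
  assumes "C \<subseteq> V" "induced_connected adj C" "w \<in> C"
  shows "card (touching C (edges V adj)) \<le> card C * (\<Delta> - 1) + 1"
proof -
  have "finite C" by (rule finite_subset_V[OF assms(1)])
  then show ?thesis
    using assms(2,3)
  proof (induction rule: induced_connected_induct)
    case singleton
    then show ?case using card_edges_at_le[of w] assms by auto
  next
    case (insert T a b)
    let ?E = "\<lambda>A. touching A (edges V adj)"
    have ab: "{a, b} \<in> ?E {b}" "{a, b} \<in> ?E T"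
      using insert by (auto simp: touching_def doubleton_in_edges_iff)
    have fin: "finite (?E A)" for A using finite_edges by (simp add: touching_def)
    have "?E (insert b T) \<subseteq> ?E T \<union> (?E {b} - {{a, b}})" using ab by (auto simp: touching_def)
    then have "card (?E (insert b T)) \<le> card (?E T) + card (?E {b} - {{a, b}})"
      using fin by (meson card_Un_le card_mono finite_Diff finite_UnI le_trans)
    also have "card (?E {b} - {{a, b}}) \<le> \<Delta> - 1"
      using card_edges_at_le[of b] insert assms(1) ab(1) by auto
    finally have "card (?E (insert b T)) \<le> Suc (card T) * (\<Delta> - 1) + 1" using insert by simp
    moreover have "card (insert b T) = Suc (card T)"
      using insert \<open>finite C\<close> finite_subset[of T C] by (intro card_insert_disjoint) auto
    ultimately show ?case by simp
  qed
qed

lemma closed_nbhd_subset: "A \<subseteq> V \<Longrightarrow> closed_nbhd adj A \<subseteq> V"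
  using adj_in_V by (auto simp: closed_nbhd_def)

lemma card_closed_nbhd_le:
  assumes "A \<subseteq> V"
  shows "card (closed_nbhd adj A) \<le> (1 + \<Delta>) * card A"
proof -
  have fin: "finite A" by (rule finite_subset_V[OF assms])
  have "closed_nbhd adj A \<subseteq> A \<union> (\<Union>a\<in>A. {b \<in> V. adj a b})"
    using adj_in_V by (auto simp: closed_nbhd_def)
  then have "card (closed_nbhd adj A) \<le> card (A \<union> (\<Union>a\<in>A. {b \<in> V. adj a b}))"
    using fin finite_V by (intro card_mono) auto
  also have "\<dots> \<le> card A + card (\<Union>a\<in>A. {b \<in> V. adj a b})" by (rule card_Un_le)
  also have "\<dots> \<le> card A + (\<Sum>a\<in>A. card {b \<in> V. adj a b})"
    by (intro add_left_mono card_UN_le[OF fin])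
  also have "\<dots> \<le> card A + (\<Sum>a\<in>A. \<Delta>)"
    using assms card_neighbours_le by (intro add_left_mono sum_mono) auto
  finally show ?thesis by (simp add: mult.commute)
qed

lemma closed_nbhd_funpow_subset: "v \<in> V \<Longrightarrow> (closed_nbhd adj ^^ m) {v} \<subseteq> V"
  by (induction m) (simp_all add: closed_nbhd_subset)

lemma card_closed_nbhd_funpow_le:
  assumes "v \<in> V"
  shows "card ((closed_nbhd adj ^^ m) {v}) \<le> (1 + \<Delta>) ^ m"
proof (induction m)
  case (Suc m)
  have "card ((closed_nbhd adj ^^ Suc m) {v}) \<le> (1 + \<Delta>) * card ((closed_nbhd adj ^^ m) {v})"
    using card_closed_nbhd_le[OF closed_nbhd_funpow_subset[OF assms]] by simp
  also have "\<dots> \<le> (1 + \<Delta>) * (1 + \<Delta>) ^ m" using Suc by (rule mult_le_mono2)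
  finally show ?case by simp
qed simp

definition adjacent_blocks :: "('v \<Rightarrow> 'v set) \<Rightarrow> 'v \<Rightarrow> 'v set" where
  "adjacent_blocks Sb v = {u \<in> V. v \<notin> Sb u \<and> (\<exists>z\<in>Sb u. adj v z)}"

lemma card_adjacent_blocks_le:
  assumes blocks: "block_system V adj k Sb" and v: "v \<in> V"
  shows "card (adjacent_blocks Sb v) \<le> (1 + \<Delta>) ^ k"
proof -
  let ?B = "(closed_nbhd adj ^^ k) {v}"
  have "u \<in> ?B" if u: "u \<in> V" "v \<notin> Sb u" "z \<in> Sb u" "adj v z" for u z
  proof -
    have S: "u \<in> Sb u" "finite (Sb u)" "card (Sb u) = k" "induced_connected adj (Sb u)"
      using blocks u finite_subset_V by (auto simp: block_system_def)
    then have "insert v (Sb u) \<subseteq> (closed_nbhd adj ^^ (card (insert v (Sb u)) - 1)) {v}"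
      using u symp_adj
      by (intro induced_connected_subset_closed_nbhd_funpow induced_connected_insert[of _ _ z]) auto
    then have "insert v (Sb u) \<subseteq> ?B" using S u by simp
    then show ?thesis using S(1) by blast
  qed
  then have "card (adjacent_blocks Sb v) \<le> card ?B"
    unfolding adjacent_blocks_def
    using finite_subset_V[OF closed_nbhd_funpow_subset[OF v]] by (intro card_mono) auto
  also have "\<dots> \<le> (1 + \<Delta>) ^ k" by (rule card_closed_nbhd_funpow_le[OF v])
  finally show ?thesis .
qed

lemma max_degree_pos:
  assumes "connected_graph V adj" "2 \<le> card V"
  shows "0 < \<Delta>"
proof -
  obtain w where w: "w \<in> V" using assms(2) by (metis card.empty equals0I not_numeral_le_zero)
  have "V \<noteq> {w}" using assms(2) by auto
  then have "{w} \<subset> V" using w by blast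
  then obtain b where "b \<in> V" "adj w b"
    using induced_connected_crossing[of adj V "{w}"] assms(1) by (auto simp: connected_graph_def)
  then have "0 < card {u \<in> V. adj w u}" using finite_V by (auto simp: card_gt_0_iff)
  also have "\<dots> \<le> \<Delta>" by (rule card_neighbours_le[OF w])
  finally show ?thesis .
qed

end

section \<open>Monochromatic components of a block\<close>

definition mono_component :: "('v \<Rightarrow> 'v \<Rightarrow> bool) \<Rightarrow> 'v set \<Rightarrow> ('v \<Rightarrow> nat) \<Rightarrow> 'v \<Rightarrow> 'v set" where
  "mono_component adj S c w = {u. (\<lambda>a b. a \<in> S \<and> b \<in> S \<and> adj a b \<and> c a = c b)\<^sup>*\<^sup>* w u}"

lemma mono_component_self: "w \<in> mono_component adj S c w"
  by (simp add: mono_component_def)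

lemma mono_component_subset:
  assumes "w \<in> S"
  shows "mono_component adj S c w \<subseteq> S"
proof
  fix u assume "u \<in> mono_component adj S c w"
  then show "u \<in> S"
    unfolding mono_component_def mem_Collect_eq using assms by (induction rule: rtranclp_induct) auto
qed

lemma mono_component_colour: "u \<in> mono_component adj S c w \<Longrightarrow> c u = c w"
  unfolding mono_component_def mem_Collect_eq by (induction rule: rtranclp_induct) auto

lemma mono_component_step:
  "\<lbrakk>a \<in> mono_component adj S c w; a \<in> S; b \<in> S; adj a b; c a = c b\<rbrakk> \<Longrightarrow> b \<in> mono_component adj S c w"
  unfolding mono_component_def mem_Collect_eq by (rule rtranclp.rtrancl_into_rtrancl) auto

lemma induced_connected_mono_component:
  assumes "symp adj"
  shows "induced_connected adj (mono_component adj S c w)"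
  unfolding mono_component_def
  by (rule induced_connected_reachable) (use assms in \<open>auto simp: symp_def\<close>)

context finite_simple_graph
begin

lemma finite_mono_edges: "finite (mono_edges V adj \<sigma>)"
  by (rule finite_subset[OF mono_edges_subset finite_edges])

lemma finite_touching_mono_edges: "finite (touching C (mono_edges V adj \<sigma>))"
  using finite_mono_edges by (simp add: touching_def)

text \<open>A monochromatic component smaller than the block has a boundary edge inside the block,
  which is not monochromatic; this saves a factor \<open>\<lambda>\<close>.\<close>
lemma card_mono_edges_touching_component_le:
  assumes S: "S \<subseteq> V" "induced_connected adj S" "w \<in> S"
  shows "card (touching (mono_component adj S c w) (mono_edges V adj (upd_block X S c)))
    \<le> card (mono_component adj S c w) * (\<Delta> - 1) + of_bool (mono_component adj S c w = S)"
    (is "card (touching ?C ?M) \<le> _")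
proof -
  have CS: "?C \<subseteq> S" by (rule mono_component_subset[OF S(3)])
  have all: "card (touching ?C (edges V adj)) \<le> card ?C * (\<Delta> - 1) + 1"
    using CS S(1) mono_component_self induced_connected_mono_component[OF symp_adj]
    by (intro card_edges_touching_connected_le[of _ w]) auto
  have sub: "touching ?C ?M \<subseteq> touching ?C (edges V adj)"
    using mono_edges_subset unfolding touching_def by blast
  have fin: "finite (touching ?C (edges V adj))" using finite_edges by (simp add: touching_def)
  show ?thesis
  proof (cases "?C = S")
    case True
    then show ?thesis using card_mono[OF fin sub] all by simp
  next
    case False
    moreover have "?C \<noteq> {}" using mono_component_self[of w] by blast
    ultimately obtain a b where ab: "a \<in> ?C" "b \<in> S - ?C" "adj a b"
      using induced_connected_crossing[OF S(2), of ?C] CS by blast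
    then have aS: "a \<in> S" using CS by auto
    then have "c a \<noteq> c b" using ab mono_component_step[of a adj S c w b] by auto
    then have "{a, b} \<notin> ?M" using ab aS by (simp add: doubleton_in_mono_edges_iff upd_block_def)
    moreover have "{a, b} \<in> touching ?C (edges V adj)"
      using ab by (simp add: touching_def doubleton_in_edges_iff)
    ultimately have "touching ?C ?M \<subset> touching ?C (edges V adj)"
      using sub by (auto simp: touching_def)
    then have "card (touching ?C ?M) < card (touching ?C (edges V adj))"
      by (rule psubset_card_mono[OF fin])
    then show ?thesis using all False by simp
  qed
qed

lemma mu_block_le_recoloured:
  assumes "C \<subseteq> S"
  shows "mu_block V adj X S c
    \<le> card (touching C (mono_edges V adj (upd_block X S c))) + mu_block V adj X S (upd_block c C d)"
proof -
  let ?M = "\<lambda>c. mono_edges V adj (upd_block X S c)"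
  have "agree_off C (upd_block X S c) (upd_block X S (upd_block c C d))"
    by (simp add: agree_off_def upd_block_def)
  from mono_edges_minus_touching_cong[OF this, of V adj]
  have "touching S (?M c) \<subseteq> touching C (?M c) \<union> touching S (?M (upd_block c C d))"
    by (auto simp: touching_def)
  then have "card (touching S (?M c)) \<le> card (touching C (?M c) \<union> touching S (?M (upd_block c C d)))"
    using finite_touching_mono_edges by (intro card_mono) auto
  also have "\<dots> \<le> card (touching C (?M c)) + card (touching S (?M (upd_block c C d)))"
    by (rule card_Un_le)
  finally show ?thesis by (simp add: mu_block_eq_card_touching)
qed

lemma mu_block_eq_if_no_conflict:
  assumes xy: "agree_off {v} x y" and v: "v \<notin> S"
    and no_conflict: "\<And>z. \<lbrakk>z \<in> S; adj v z\<rbrakk> \<Longrightarrow> c z \<noteq> x v \<and> c z \<noteq> y v"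
  shows "mu_block V adj x S c = mu_block V adj y S c"
proof -
  have "e \<in> mono_edges V adj (upd_block x S c) \<longleftrightarrow> e \<in> mono_edges V adj (upd_block y S c)"
    if e: "e \<inter> S \<noteq> {}" "e \<in> edges V adj" for e
  proof (cases "v \<in> e")
    case True
    then obtain z where "e = {v, z}" using e(2) by (auto simp: edges_def)
    then have z: "e = {v, z}" "z \<in> S" "adj v z" using e v doubleton_in_edges_iff by auto
    then have "c z \<noteq> x v" "c z \<noteq> y v" using no_conflict by auto
    then show ?thesis using z(2) v unfolding z(1) doubleton_in_mono_edges_iff upd_block_def by auto
  next
    case False
    then show ?thesis
      using xy by (intro mono_edges_cong) (auto simp: agree_off_def upd_block_def)
  qed
  then have "touching S (mono_edges V adj (upd_block x S c))
      = touching S (mono_edges V adj (upd_block y S c))"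
    unfolding touching_def using mono_edges_subset[of V adj "upd_block x S c"]
      mono_edges_subset[of V adj "upd_block y S c"] by auto
  then show ?thesis by (simp add: mu_block_eq_card_touching)
qed

end

section \<open>Block updates\<close>

lemma finite_block_colourings: "finite S \<Longrightarrow> finite (block_colourings S q)"
  using finite_set_of_finite_funs[of S "{..<q}" 0]
  by (rule finite_subset[rotated]) (auto simp: block_colourings_def)

lemma card_block_colourings:
  assumes "finite S"
  shows "card (block_colourings S q) = q ^ card S"
proof -
  have "bij_betw (\<lambda>c. restrict c S) (block_colourings S q) (S \<rightarrow>\<^sub>E {..<q})"
    by (rule bij_betw_byWitness[where f' = "\<lambda>c v. if v \<in> S then c v else 0"])
       (auto simp: block_colourings_def fun_eq_iff PiE_def extensional_def)
  then show ?thesis using card_funcsetE[OF assms, of "{..<q}"] by (simp add: bij_betw_same_card)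
qed

lemma configs_eq_block_colourings: "configs V q = block_colourings V q"
  by (simp add: configs_def block_colourings_def)

lemma upd_block_in_configs:
  "\<lbrakk>X \<in> configs V q; S \<subseteq> V; c \<in> block_colourings S q\<rbrakk> \<Longrightarrow> upd_block X S c \<in> configs V q"
  by (auto simp: configs_def block_colourings_def upd_block_def)

lemma upd_block_in_block_colourings:
  "\<lbrakk>C \<subseteq> S; c \<in> block_colourings S q; d \<in> block_colourings C q\<rbrakk> \<Longrightarrow> upd_block c C d \<in> block_colourings S q"
  by (auto simp: block_colourings_def upd_block_def)

lemma inj_on_recolour:
  assumes "\<And>c u. \<lbrakk>c \<in> A; u \<in> C\<rbrakk> \<Longrightarrow> c u = a"
  shows "inj_on (\<lambda>(c, d). upd_block c C d) (A \<times> block_colourings C q)"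
proof (rule inj_onI, clarify)
  fix c d c' d'
  assume c: "c \<in> A" "c' \<in> A" and d: "d \<in> block_colourings C q" "d' \<in> block_colourings C q"
    and eq: "upd_block c C d = upd_block c' C d'"
  have "c u = c' u \<and> d u = d' u" for u
    using fun_cong[OF eq, of u] assms[OF c(1), of u] assms[OF c(2), of u] d
    by (cases "u \<in> C") (auto simp: upd_block_def block_colourings_def)
  then show "c = c' \<and> d = d'" by (simp add: fun_eq_iff)
qed

lemma card_subsets_containing:
  assumes "finite S" "w \<in> S"
  shows "card {C. C \<subseteq> S \<and> w \<in> C} = 2 ^ (card S - 1)"
proof -
  have "bij_betw (insert w) (Pow (S - {w})) {C. C \<subseteq> S \<and> w \<in> C}"
    by (rule bij_betw_byWitness[where f' = "\<lambda>C. C - {w}"]) (use assms(2) in auto)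
  then have "card {C. C \<subseteq> S \<and> w \<in> C} = card (Pow (S - {w}))" by (simp add: bij_betw_same_card)
  then show ?thesis using assms by (simp add: card_Pow)
qed

locale potts = finite_simple_graph V adj
  for V :: "'v set" and adj :: "'v \<Rightarrow> 'v \<Rightarrow> bool" +
  fixes q :: nat and lam :: real
  assumes q_pos: "0 < q" and lam_ge_1: "1 \<le> lam"
begin

abbreviation \<Omega> :: "('v \<Rightarrow> nat) set" where
  "\<Omega> \<equiv> configs V q"

abbreviation block_weight :: "('v \<Rightarrow> nat) \<Rightarrow> 'v set \<Rightarrow> ('v \<Rightarrow> nat) \<Rightarrow> real" where
  "block_weight X S c \<equiv> lam ^ mu_block V adj X S c"

definition block_law :: "('v \<Rightarrow> nat) \<Rightarrow> 'v set \<Rightarrow> ('v \<Rightarrow> nat) \<Rightarrow> real" where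
  "block_law X S = normalise (block_colourings S q) (block_weight X S)"

definition update_prob :: "('v \<Rightarrow> nat) \<Rightarrow> 'v set \<Rightarrow> (('v \<Rightarrow> nat) \<Rightarrow> bool) \<Rightarrow> real" where
  "update_prob X S E = (\<Sum>c | c \<in> block_colourings S q \<and> E c. block_law X S c)"

definition update_expectation :: "(('v \<Rightarrow> nat) \<Rightarrow> real) \<Rightarrow> 'v set \<Rightarrow> ('v \<Rightarrow> nat) \<Rightarrow> real" where
  "update_expectation f S X = (\<Sum>c\<in>block_colourings S q. block_law X S c * f (upd_block X S c))"

lemma finite_colourings: "S \<subseteq> V \<Longrightarrow> finite (block_colourings S q)"
  by (intro finite_block_colourings finite_subset_V)

lemma finite_configs: "finite \<Omega>"
  unfolding configs_eq_block_colourings by (rule finite_colourings) simp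

lemma block_colourings_nonempty: "block_colourings S q \<noteq> {}"
proof -
  have "(\<lambda>_. 0) \<in> block_colourings S q" using q_pos by (simp add: block_colourings_def)
  then show ?thesis by blast
qed

lemma total_block_weight_pos: "S \<subseteq> V \<Longrightarrow> 0 < sum (block_weight X S) (block_colourings S q)"
  using lam_ge_1 by (intro sum_pos finite_colourings block_colourings_nonempty) auto

lemma block_law_nonneg: "c \<in> block_colourings S q \<Longrightarrow> 0 \<le> block_law X S c"
  unfolding block_law_def using lam_ge_1 by (intro normalise_nonneg) auto

lemma sum_block_law: "S \<subseteq> V \<Longrightarrow> sum (block_law X S) (block_colourings S q) = 1"
  unfolding block_law_def using total_block_weight_pos[of S X] by (intro sum_normalise) simp

lemma update_prob_eq_weight_ratio:
  "update_prob X S E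
    = (\<Sum>c | c \<in> block_colourings S q \<and> E c. block_weight X S c)
      / sum (block_weight X S) (block_colourings S q)"
  by (simp add: update_prob_def block_law_def normalise_def sum_divide_distrib)

lemma update_prob_union_bound:
  assumes S: "S \<subseteq> V" and I: "finite I"
    and cover: "\<And>c. \<lbrakk>c \<in> block_colourings S q; E c\<rbrakk> \<Longrightarrow> \<exists>i\<in>I. F i c"
  shows "update_prob X S E \<le> (\<Sum>i\<in>I. update_prob X S (F i))"
proof -
  let ?A = "block_colourings S q"
  note fin = finite_colourings[OF S]
  have "update_prob X S E = (\<Sum>c\<in>?A. if E c then block_law X S c else 0)"
    unfolding update_prob_def using fin by (simp add: sum.inter_filter)
  also have "\<dots> \<le> (\<Sum>c\<in>?A. \<Sum>i\<in>I. if F i c then block_law X S c else 0)"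
  proof (rule sum_mono)
    fix c assume c: "c \<in> ?A"
    note nonneg = block_law_nonneg[OF c, of X]
    show "(if E c then block_law X S c else 0) \<le> (\<Sum>i\<in>I. if F i c then block_law X S c else 0)"
    proof (cases "E c")
      case True
      then obtain i where i: "i \<in> I" "F i c" using cover c by blast
      then have "block_law X S c = (if F i c then block_law X S c else 0)" by simp
      also have "\<dots> \<le> (\<Sum>i\<in>I. if F i c then block_law X S c else 0)"
        using nonneg by (intro member_le_sum i I) auto
      finally show ?thesis using True by simp
    qed (use nonneg in \<open>auto intro: sum_nonneg\<close>)
  qed
  also have "\<dots> = (\<Sum>i\<in>I. update_prob X S (F i))"
    unfolding update_prob_def using fin by (subst sum.swap) (simp add: sum.inter_filter)
  finally show ?thesis .
qed

text \<open>Recolouring \<open>C\<close> freely is injective on pairs of a colouring that is constant on \<open>C\<close> and a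
  new colouring of \<open>C\<close>, and it loses at most a factor \<open>\<lambda>\<^bsup>m\<^esup>\<close> of the weight.\<close>
lemma update_prob_constant_le:
  assumes S: "S \<subseteq> V" and C: "C \<subseteq> S"
    and const: "\<And>c u. \<lbrakk>c \<in> block_colourings S q; E c; u \<in> C\<rbrakk> \<Longrightarrow> c u = a"
    and few: "\<And>c. \<lbrakk>c \<in> block_colourings S q; E c\<rbrakk>
      \<Longrightarrow> card (touching C (mono_edges V adj (upd_block X S c))) \<le> m"
  shows "update_prob X S E \<le> lam ^ m / real q ^ card C"
proof -
  let ?A = "{c \<in> block_colourings S q. E c}"
  let ?Z = "sum (block_weight X S) (block_colourings S q)"
  let ?P = "?A \<times> block_colourings C q"
  let ?recolour = "\<lambda>(c, d). upd_block c C d"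
  have "finite C" using S C by (intro finite_subset_V) auto
  then have card_C: "real (card (block_colourings C q)) = real q ^ card C"
    by (simp add: card_block_colourings)
  have inj: "inj_on ?recolour ?P" using const by (intro inj_on_recolour) auto
  have "(\<Sum>c\<in>?A. block_weight X S c) * real q ^ card C = (\<Sum>(c, d)\<in>?P. block_weight X S c)"
    by (simp add: card_C sum_distrib_left mult.commute flip: sum.cartesian_product)
  also have "\<dots> \<le> (\<Sum>p\<in>?P. lam ^ m * block_weight X S (?recolour p))"
  proof (rule sum_mono, clarify)
    fix c d assume c: "c \<in> block_colourings S q" "E c"
    have "mu_block V adj X S c \<le> m + mu_block V adj X S (upd_block c C d)"
      using mu_block_le_recoloured[OF C, of X c d] few[OF c] by linarith
    from power_increasing[OF this lam_ge_1]
    show "block_weight X S c \<le> lam ^ m * block_weight X S (upd_block c C d)"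
      by (simp add: power_add)
  qed
  also have "\<dots> = lam ^ m * sum (block_weight X S) (?recolour ` ?P)"
    by (simp add: sum.reindex[OF inj] sum_distrib_left)
  also have "\<dots> \<le> lam ^ m * ?Z"
    using lam_ge_1 finite_colourings[OF S] upd_block_in_block_colourings[OF C]
    by (intro mult_left_mono sum_mono2) auto
  finally have "(\<Sum>c\<in>?A. block_weight X S c) * real q ^ card C \<le> lam ^ m * ?Z" .
  then show ?thesis
    using total_block_weight_pos[OF S, of X] q_pos
    unfolding update_prob_eq_weight_ratio by (simp add: divide_le_eq le_divide_eq field_simps)
qed

text \<open>The difference \<open>\<Delta> - 1\<close> is truncated: it is \<open>0\<close> in an edgeless graph.\<close>
definition component_rate :: "nat \<Rightarrow> real" where
  "component_rate m = lam powr (real (\<Delta> - 1) + 1 / real m) / real q"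

lemma component_rate_nonneg: "0 \<le> component_rate m"
  by (simp add: component_rate_def)

lemma power_div_le_component_rate_power:
  assumes "j = m \<Longrightarrow> 0 < m"
  shows "lam ^ (j * (\<Delta> - 1) + of_bool (j = m)) / real q ^ j \<le> component_rate m ^ j"
proof -
  have "lam ^ (j * (\<Delta> - 1) + of_bool (j = m)) = lam powr real (j * (\<Delta> - 1) + of_bool (j = m))"
    using lam_ge_1 by (intro powr_realpow[symmetric]) simp
  also have "\<dots> \<le> lam powr ((real (\<Delta> - 1) + 1 / real m) * real j)"
  proof (rule powr_mono[OF _ lam_ge_1])
    show "real (j * (\<Delta> - 1) + of_bool (j = m)) \<le> (real (\<Delta> - 1) + 1 / real m) * real j"
      using assms by (cases "j = m") (simp_all add: distrib_right)
  qed
  also have "\<dots> = (lam powr (real (\<Delta> - 1) + 1 / real m)) ^ j"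
    using lam_ge_1 by (simp add: powr_power mult.commute)
  finally show ?thesis
    by (simp add: component_rate_def power_divide divide_right_mono)
qed

lemma update_prob_mono_component_le:
  assumes S: "S \<subseteq> V" "induced_connected adj S" and C: "C \<subseteq> S" "w \<in> C"
  shows "update_prob X S (\<lambda>c. c w = a \<and> mono_component adj S c w = C) \<le> component_rate (card S) ^ card C"
proof -
  have fin: "finite S" by (rule finite_subset_V[OF S(1)])
  have wS: "w \<in> S" using C by blast
  have "update_prob X S (\<lambda>c. c w = a \<and> mono_component adj S c w = C)
      \<le> lam ^ (card C * (\<Delta> - 1) + of_bool (C = S)) / real q ^ card C"
  proof (rule update_prob_constant_le[OF S(1) C(1)])
    show "c u = a" if "c w = a \<and> mono_component adj S c w = C" "u \<in> C" for c u
      using that mono_component_colour[of u adj S c w] by auto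
    show "card (touching C (mono_edges V adj (upd_block X S c))) \<le> card C * (\<Delta> - 1) + of_bool (C = S)"
      if "c w = a \<and> mono_component adj S c w = C" for c
      using card_mono_edges_touching_component_le[OF S wS, where c = c and X = X] that by auto
  qed
  also have "C = S \<longleftrightarrow> card C = card S" using C(1) fin card_subset_eq by blast
  also have "lam ^ (card C * (\<Delta> - 1) + of_bool (card C = card S)) / real q ^ card C
      \<le> component_rate (card S) ^ card C"
    using wS fin by (intro power_div_le_component_rate_power) (auto simp: card_gt_0_iff)
  finally show ?thesis .
qed

lemma update_prob_colour_le:
  assumes S: "S \<subseteq> V" "induced_connected adj S" "w \<in> S" and rate: "component_rate (card S) \<le> 1"
  shows "update_prob X S (\<lambda>c. c w = a) \<le> 2 ^ (card S - 1) * component_rate (card S)"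
proof -
  let ?T = "{C. C \<subseteq> S \<and> w \<in> C}"
  have fin: "finite S" by (rule finite_subset_V[OF S(1)])
  have "update_prob X S (\<lambda>c. c w = a)
      \<le> (\<Sum>C\<in>?T. update_prob X S (\<lambda>c. c w = a \<and> mono_component adj S c w = C))"
  proof (rule update_prob_union_bound[OF S(1)])
    show "finite ?T" using fin by simp
    show "\<exists>C\<in>?T. c w = a \<and> mono_component adj S c w = C" if "c w = a" for c
      using that mono_component_self[of w adj S c] mono_component_subset[OF S(3), of adj c] by simp
  qed
  also have "\<dots> \<le> (\<Sum>C\<in>?T. component_rate (card S))"
  proof (rule sum_mono)
    fix C assume C: "C \<in> ?T"
    then have "0 < card C" using fin finite_subset by (auto simp: card_gt_0_iff)
    then have "component_rate (card S) ^ card C \<le> component_rate (card S)"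
      using power_decreasing[of 1 "card C" "component_rate (card S)"] component_rate_nonneg rate by simp
    then show "update_prob X S (\<lambda>c. c w = a \<and> mono_component adj S c w = C) \<le> component_rate (card S)"
      using update_prob_mono_component_le[OF S(1,2), of C w X a] C by auto
  qed
  also have "\<dots> = 2 ^ (card S - 1) * component_rate (card S)"
    using card_subsets_containing[OF fin S(3)] by simp
  finally show ?thesis .
qed

end

section \<open>Updating a block next to a discrepancy\<close>

context potts
begin

lemma update_prob_hits_colours_le:
  assumes S: "S \<subseteq> V" "induced_connected adj S" and N: "N \<subseteq> S" and B: "finite B"
    and rate: "component_rate (card S) \<le> 1"
  shows "update_prob X S (\<lambda>c. \<exists>z\<in>N. c z \<in> B)
    \<le> real (card N) * real (card B) * 2 ^ (card S - 1) * component_rate (card S)"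
proof -
  have "finite N" using N S(1) by (intro finite_subset_V) auto
  then have "update_prob X S (\<lambda>c. \<exists>z\<in>N. c z \<in> B)
      \<le> (\<Sum>(z, a)\<in>N \<times> B. update_prob X S (\<lambda>c. c z = a))"
    unfolding case_prod_unfold by (intro update_prob_union_bound[OF S(1)]) (use B in auto)
  also have "\<dots> \<le> (\<Sum>(z, a)\<in>N \<times> B. 2 ^ (card S - 1) * component_rate (card S))"
  proof (rule sum_mono, clarify)
    fix z a assume "z \<in> N"
    then show "update_prob X S (\<lambda>c. c z = a) \<le> 2 ^ (card S - 1) * component_rate (card S)"
      using N by (intro update_prob_colour_le S rate) auto
  qed
  also have "\<dots> = real (card N) * real (card B) * 2 ^ (card S - 1) * component_rate (card S)"
    by (simp add: case_prod_unfold card_cartesian_product)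
  finally show ?thesis .
qed

lemma tv_dist_block_law_le:
  assumes S: "S \<subseteq> V" "induced_connected adj S" "S \<noteq> {}" and v: "v \<notin> S" and xy: "agree_off {v} x y"
    and rate: "component_rate (card S) \<le> 1"
  shows "tv_dist (block_colourings S q) (block_law x S) (block_law y S)
    \<le> real (card {z \<in> S. adj v z}) * 2 ^ card S * component_rate (card S)"
proof -
  let ?N = "{z \<in> S. adj v z}"
  let ?conflict = "\<lambda>c. \<exists>z\<in>?N. c z \<in> {x v, y v}"
  have "0 < card S" using S finite_subset_V by (simp add: card_gt_0_iff)
  then have power_card_S: "2 * 2 ^ (card S - 1) = (2 :: real) ^ card S" by (cases "card S") auto
  have conflict: "update_prob X S ?conflict \<le> real (card ?N) * 2 ^ card S * component_rate (card S)" for X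
  proof -
    have "update_prob X S ?conflict
        \<le> real (card ?N) * real (card {x v, y v}) * 2 ^ (card S - 1) * component_rate (card S)"
      by (intro update_prob_hits_colours_le S rate) auto
    also have "\<dots> \<le> real (card ?N) * 2 * 2 ^ (card S - 1) * component_rate (card S)"
      using component_rate_nonneg
      by (intro mult_right_mono mult_left_mono) (auto simp: card_insert_if)
    also have "\<dots> = real (card ?N) * 2 ^ card S * component_rate (card S)"
      by (simp only: mult.assoc power_card_S[symmetric])
    finally show ?thesis .
  qed
  show ?thesis
    unfolding block_law_def
  proof (rule tv_dist_normalise_le[where E = ?conflict])
    show "block_weight x S c = block_weight y S c" if "\<not> ?conflict c" for c
      using mu_block_eq_if_no_conflict[OF xy v, of c] that by auto
  qed (use total_block_weight_pos[OF S(1)] finite_colourings[OF S(1)] lam_ge_1 conflict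
      in \<open>auto simp: update_prob_def block_law_def\<close>)
qed

text \<open>The first term bounds the discrepancy kept by the identical update of both configurations,
  the second one the effect of passing from the law of one update to the other.\<close>
lemma update_expectation_diff_le:
  assumes xy: "x \<in> \<Omega>" "y \<in> \<Omega>" "agree_off {v} x y" and S: "S \<subseteq> V"
    and f: "lipschitz_wrt \<Omega> (hamming V) L f" "0 \<le> L"
  shows "update_expectation f S x - update_expectation f S y
    \<le> L + L * real (card S) * tv_dist (block_colourings S q) (block_law x S) (block_law y S)"
proof -
  let ?A = "block_colourings S q" and ?g = "\<lambda>c. f (upd_block y S c)"
  have lip: "f (upd_block X S c) - f (upd_block Y S d) \<le> L * real (card T)"
    if "X \<in> \<Omega>" "Y \<in> \<Omega>" "c \<in> ?A" "d \<in> ?A" "finite T" "agree_off T (upd_block X S c) (upd_block Y S d)"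
    for X Y c d T
  proof -
    have "f (upd_block X S c) - f (upd_block Y S d) \<le> L * hamming V (upd_block X S c) (upd_block Y S d)"
      using f(1) that S upd_block_in_configs unfolding lipschitz_wrt_def by blast
    also have "\<dots> \<le> L * real (card T)"
      using f(2) that by (intro mult_left_mono hamming_le_card_agree_off)
    finally show ?thesis .
  qed
  have "update_expectation f S x - (\<Sum>c\<in>?A. block_law x S c * ?g c)
      = (\<Sum>c\<in>?A. block_law x S c * (f (upd_block x S c) - ?g c))"
    by (simp add: update_expectation_def right_diff_distrib sum_subtractf)
  also have "\<dots> \<le> (\<Sum>c\<in>?A. block_law x S c * L)"
    using lip[of x y _ _ "{v}"] xy agree_off_upd_block[OF xy(3)]
    by (intro sum_mono mult_left_mono block_law_nonneg) auto
  also have "\<dots> = L" using sum_block_law[OF S] by (simp flip: sum_distrib_right)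
  finally have same_law: "update_expectation f S x - (\<Sum>c\<in>?A. block_law x S c * ?g c) \<le> L" .
  have "?g c - ?g d \<le> L * real (card S)" if "c \<in> ?A" "d \<in> ?A" for c d
    by (rule lip[OF xy(2,2) that finite_subset_V[OF S] agree_off_upd_block_colours])
  then have "(\<Sum>c\<in>?A. block_law x S c * ?g c) - (\<Sum>c\<in>?A. block_law y S c * ?g c)
      \<le> L * real (card S) * tv_dist ?A (block_law x S) (block_law y S)"
    by (intro sum_diff_le_oscillation_times_tv_dist finite_colourings[OF S])
       (simp_all add: sum_block_law[OF S])
  then show ?thesis using same_law by (simp add: update_expectation_def)
qed

lemma update_expectation_cong: "agree_off S x y \<Longrightarrow> update_expectation f S x = update_expectation f S y"
  by (simp add: update_expectation_def block_law_def mu_block_def upd_block_cong[of S x y])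

lemma update_expectation_const: "S \<subseteq> V \<Longrightarrow> update_expectation (\<lambda>_. 1) S X = 1"
  by (simp add: update_expectation_def sum_block_law)

lemma sum_block_step:
  assumes "X \<in> \<Omega>" "S \<subseteq> V"
  shows "(\<Sum>Y\<in>\<Omega>. block_step V adj q lam S X Y * f Y) = update_expectation f S X"
proof -
  let ?A = "block_colourings S q"
  have "(\<Sum>Y\<in>\<Omega>. block_step V adj q lam S X Y * f Y)
      = (\<Sum>Y\<in>\<Omega>. \<Sum>c\<in>{c \<in> ?A. upd_block X S c = Y}. block_law X S c * f (upd_block X S c))"
    by (intro sum.cong)
      (auto simp: block_step_def block_law_def normalise_def sum_divide_distrib sum_distrib_right)
  also have "\<dots> = update_expectation f S X"
    unfolding update_expectation_def using upd_block_in_configs[OF assms]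
    by (intro sum.group finite_colourings finite_configs assms) auto
  finally show ?thesis .
qed

lemma kernel_apply_block_dynamics:
  assumes "X \<in> \<Omega>" "\<And>v. v \<in> V \<Longrightarrow> Sb v \<subseteq> V"
  shows "kernel_apply \<Omega> (block_dynamics V adj q lam Sb) f X
    = (\<Sum>v\<in>V. update_expectation f (Sb v) X) / real (card V)"
proof -
  have "kernel_apply \<Omega> (block_dynamics V adj q lam Sb) f X
      = (\<Sum>v\<in>V. \<Sum>Y\<in>\<Omega>. block_step V adj q lam (Sb v) X Y * f Y) / real (card V)"
    unfolding kernel_apply_def block_dynamics_def
    by (subst sum.swap) (simp add: sum_divide_distrib sum_distrib_right)
  then show ?thesis using sum_block_step[OF assms(1)] assms(2) by simp
qed

end

section \<open>The Gibbs distribution is stationary\<close>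

context potts
begin

lemma gibbs_eq_normalise: "gibbs V adj q lam = normalise \<Omega> (\<lambda>\<sigma>. lam ^ mu V adj \<sigma>)"
  by (simp add: gibbs_def normalise_def fun_eq_iff)

lemma gibbs_nonneg: "\<sigma> \<in> \<Omega> \<Longrightarrow> 0 \<le> gibbs V adj q lam \<sigma>"
  unfolding gibbs_eq_normalise using lam_ge_1 by (intro normalise_nonneg) auto

lemma configs_nonempty: "\<Omega> \<noteq> {}"
  unfolding configs_eq_block_colourings by (rule block_colourings_nonempty)

lemma sum_gibbs: "sum (gibbs V adj q lam) \<Omega> = 1"
proof -
  have "0 < (\<Sum>\<sigma>\<in>\<Omega>. lam ^ mu V adj \<sigma>)"
    using lam_ge_1 by (intro sum_pos finite_configs configs_nonempty) auto
  then show ?thesis unfolding gibbs_eq_normalise by (intro sum_normalise) simp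
qed

lemma mu_eq_card_touching_add:
  "mu V adj \<sigma> = card (touching S (mono_edges V adj \<sigma>))
    + card (mono_edges V adj \<sigma> - touching S (mono_edges V adj \<sigma>))"
proof -
  have "touching S (mono_edges V adj \<sigma>) \<subseteq> mono_edges V adj \<sigma>" by (auto simp: touching_def)
  then show ?thesis
    unfolding mu_def using card_mono[OF finite_mono_edges]
    by (simp add: card_Diff_subset finite_touching_mono_edges)
qed

lemma block_step_eq:
  assumes "S \<subseteq> V" "y \<in> \<Omega>"
  shows "block_step V adj q lam S x y = (if agree_off S x y
    then lam ^ card (touching S (mono_edges V adj y))
      / sum (block_weight x S) (block_colourings S q)
    else 0)"
proof (cases "agree_off S x y")
  case True
  let ?c = "\<lambda>u. if u \<in> S then y u else 0"
  have upd: "upd_block x S ?c = y" using True by (auto simp: agree_off_def upd_block_def)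
  have "{c \<in> block_colourings S q. upd_block x S c = y} = {?c}"
  proof (intro equalityI subsetI)
    fix c assume "c \<in> {c \<in> block_colourings S q. upd_block x S c = y}"
    then show "c \<in> {?c}" by (auto simp: upd_block_def block_colourings_def)
  next
    fix c assume "c \<in> {?c}"
    moreover have "?c \<in> block_colourings S q"
      using assms by (auto simp: block_colourings_def configs_def)
    ultimately show "c \<in> {c \<in> block_colourings S q. upd_block x S c = y}" using upd by simp
  qed
  then show ?thesis using True by (simp add: block_step_def mu_block_eq_card_touching upd)
next
  case False
  then have "{c \<in> block_colourings S q. upd_block x S c = y} = {}"
    by (auto simp: agree_off_def upd_block_def)
  then show ?thesis using False by (simp only: block_step_def sum.empty div_0 if_False)
qed

lemma block_step_detailed_balance:
  assumes "S \<subseteq> V" "x \<in> \<Omega>" "y \<in> \<Omega>"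
  shows "lam ^ mu V adj x * block_step V adj q lam S x y
    = lam ^ mu V adj y * block_step V adj q lam S y x"
proof (cases "agree_off S x y")
  case True
  then have "upd_block x S = upd_block y S" by (rule upd_block_cong)
  then have "sum (block_weight x S) (block_colourings S q) = sum (block_weight y S) (block_colourings S q)"
    by (simp add: mu_block_def)
  then show ?thesis
    using True agree_off_commute[of S x y] mono_edges_minus_touching_cong[OF True, of V adj]
      mu_eq_card_touching_add[of x S] mu_eq_card_touching_add[of y S]
    by (simp add: block_step_eq assms power_add)
next
  case False
  then show ?thesis using agree_off_commute[of S x y] by (simp add: block_step_eq assms)
qed

lemma gibbs_stationary:
  assumes Sb: "\<And>v. v \<in> V \<Longrightarrow> Sb v \<subseteq> V" and V: "V \<noteq> {}"
  shows "stationary \<Omega> (block_dynamics V adj q lam Sb) (gibbs V adj q lam)"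
proof (rule detailed_balance_stationary)
  fix x y assume xy: "x \<in> \<Omega>" "y \<in> \<Omega>"
  have "(\<Sum>v\<in>V. lam ^ mu V adj x * block_step V adj q lam (Sb v) x y)
      = (\<Sum>v\<in>V. lam ^ mu V adj y * block_step V adj q lam (Sb v) y x)"
    using xy by (intro sum.cong refl block_step_detailed_balance Sb)
  then show "gibbs V adj q lam x * block_dynamics V adj q lam Sb x y
      = gibbs V adj q lam y * block_dynamics V adj q lam Sb y x"
    by (simp add: gibbs_def block_dynamics_def times_divide_times_eq flip: sum_distrib_left)
next
  fix x assume x: "x \<in> \<Omega>"
  have "sum (block_dynamics V adj q lam Sb x) \<Omega>
      = (\<Sum>v\<in>V. update_expectation (\<lambda>_. 1) (Sb v) x) / real (card V)"
    using kernel_apply_block_dynamics[OF x Sb, where f = "\<lambda>_. 1"] by (simp add: kernel_apply_def)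
  also have "\<dots> = 1" using Sb V finite_V by (simp add: update_expectation_const)
  finally show "sum (block_dynamics V adj q lam Sb x) \<Omega> = 1" .
qed

end

section \<open>Contraction of the block dynamics\<close>

locale potts_blocks = potts V adj q lam
  for V :: "'v set" and adj :: "'v \<Rightarrow> 'v \<Rightarrow> bool" and q :: nat and lam :: real +
  fixes k :: nat and Sb :: "'v \<Rightarrow> 'v set"
  assumes blocks: "block_system V adj k Sb"
begin

lemma blockD:
  assumes "u \<in> V"
  shows "u \<in> Sb u" "Sb u \<subseteq> V" "card (Sb u) = k" "induced_connected adj (Sb u)"
  using blocks assms by (auto simp: block_system_def)

text \<open>Bounds the expected number of discrepancies created by an update of a block adjacent to a
  discrepancy.\<close>
definition spread :: real where
  "spread = real k * real k * 2 ^ k * component_rate k"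

lemma spread_nonneg: "0 \<le> spread"
  by (simp add: spread_def component_rate_nonneg)

lemma update_expectation_neighbours_le:
  assumes xy: "x \<in> \<Omega>" "y \<in> \<Omega>" "agree_off {v} x y" and u: "u \<in> V"
    and f: "lipschitz_wrt \<Omega> (hamming V) L f" "0 \<le> L" and rate: "component_rate k \<le> 1"
  shows "update_expectation f (Sb u) x - update_expectation f (Sb u) y
    \<le> L * (of_bool (u \<noteq> v) + of_bool (u \<in> adjacent_blocks Sb v) * spread)"
proof (cases "v \<in> Sb u")
  case True
  then have "agree_off (Sb u) x y" using xy(3) by (auto simp: agree_off_def)
  then show ?thesis
    using f(2) spread_nonneg update_expectation_cong[of "Sb u" x y f] by simp
next
  case v: False
  let ?N = "{z \<in> Sb u. adj v z}"
  let ?tv = "tv_dist (block_colourings (Sb u) q) (block_law x (Sb u)) (block_law y (Sb u))"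
  have "?tv \<le> real (card ?N) * 2 ^ k * component_rate k"
    using tv_dist_block_law_le[of "Sb u" v x y] blockD[OF u] v xy(3) rate by auto
  also have "\<dots> \<le> of_bool (u \<in> adjacent_blocks Sb v) * real k * 2 ^ k * component_rate k"
  proof (cases "u \<in> adjacent_blocks Sb v")
    case True
    have "finite (Sb u)" by (rule finite_subset_V[OF blockD(2)[OF u]])
    then have "card ?N \<le> k" using blockD(3)[OF u] card_mono[of "Sb u" ?N] by auto
    then show ?thesis using True component_rate_nonneg by (simp add: mult_right_mono)
  next
    case False
    then have "?N = {}" using u v by (auto simp: adjacent_blocks_def)
    then have "card ?N = 0" by (simp only: card.empty)
    then show ?thesis using False by simp
  qed
  finally have tv: "?tv \<le> of_bool (u \<in> adjacent_blocks Sb v) * real k * 2 ^ k * component_rate k" .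
  have "update_expectation f (Sb u) x - update_expectation f (Sb u) y \<le> L + L * real k * ?tv"
    using update_expectation_diff_le[OF xy blockD(2)[OF u] f] blockD(3)[OF u] by simp
  also have "\<dots> \<le> L + L * real k * (of_bool (u \<in> adjacent_blocks Sb v) * real k * 2 ^ k * component_rate k)"
    using f(2) tv by (intro add_left_mono mult_left_mono) auto
  also have "\<dots> = L * (of_bool (u \<noteq> v) + of_bool (u \<in> adjacent_blocks Sb v) * spread)"
    using v blockD(1)[OF u] by (auto simp: spread_def algebra_simps)
  finally show ?thesis .
qed

lemma sum_update_expectation_neighbours_le:
  assumes xy: "x \<in> \<Omega>" "y \<in> \<Omega>" "agree_off {v} x y" and v: "v \<in> V"
    and f: "lipschitz_wrt \<Omega> (hamming V) L f" "0 \<le> L" and rate: "component_rate k \<le> 1"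
  shows "(\<Sum>u\<in>V. update_expectation f (Sb u) x) - (\<Sum>u\<in>V. update_expectation f (Sb u) y)
    \<le> L * (real (card V) - 1 + (1 + real \<Delta>) ^ k * spread)"
proof -
  have "(\<Sum>u\<in>V. update_expectation f (Sb u) x) - (\<Sum>u\<in>V. update_expectation f (Sb u) y)
      = (\<Sum>u\<in>V. update_expectation f (Sb u) x - update_expectation f (Sb u) y)"
    by (simp add: sum_subtractf)
  also have "\<dots> \<le> (\<Sum>u\<in>V. L * (of_bool (u \<noteq> v) + of_bool (u \<in> adjacent_blocks Sb v) * spread))"
    by (intro sum_mono update_expectation_neighbours_le xy f rate)
  also have "\<dots> = L * (real (card {u \<in> V. u \<noteq> v}) + real (card {u \<in> V. u \<in> adjacent_blocks Sb v}) * spread)"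
    using finite_V by (simp add: sum.distrib flip: sum_distrib_left sum_distrib_right) (simp add: Int_def)
  also have "{u \<in> V. u \<noteq> v} = V - {v}" by auto
  also have "real (card (V - {v})) = real (card V) - 1"
    using v finite_V card_gt_0_iff[of V] by (auto simp: of_nat_diff)
  also have "{u \<in> V. u \<in> adjacent_blocks Sb v} = adjacent_blocks Sb v"
    by (auto simp: adjacent_blocks_def)
  also have "L * (real (card V) - 1 + real (card (adjacent_blocks Sb v)) * spread)
      \<le> L * (real (card V) - 1 + (1 + real \<Delta>) ^ k * spread)"
  proof -
    have "real (card (adjacent_blocks Sb v)) \<le> (1 + real \<Delta>) ^ k"
      using of_nat_mono[OF card_adjacent_blocks_le[OF blocks v], where 'a = real] by simp
    then show ?thesis
      using f(2) spread_nonneg by (intro mult_left_mono add_left_mono mult_right_mono) auto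
  qed
  finally show ?thesis .
qed

lemma block_dynamics_contraction:
  assumes rate: "component_rate k \<le> 1" and \<delta>: "(1 + real \<Delta>) ^ k * spread \<le> \<delta>"
  shows "lipschitz_contraction \<Omega> (hamming V) (1 - (1 - \<delta>) / real (card V)) (block_dynamics V adj q lam Sb)"
  unfolding lipschitz_contraction_def
proof (intro allI impI)
  let ?n = "real (card V)" and ?P = "kernel_apply \<Omega> (block_dynamics V adj q lam Sb)"
  fix L f assume f: "0 \<le> L \<and> lipschitz_wrt \<Omega> (hamming V) L f"
  show "lipschitz_wrt \<Omega> (hamming V) ((1 - (1 - \<delta>) / ?n) * L) (?P f)"
  proof (rule lipschitz_hammingI[OF finite_V])
    fix x y v assume xy: "x \<in> \<Omega>" "y \<in> \<Omega>" and v: "v \<in> V" and agree: "agree_off {v} x y"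
    have n: "0 < ?n" using v finite_V by (auto simp: card_gt_0_iff)
    have "?P f x - ?P f y
        = ((\<Sum>u\<in>V. update_expectation f (Sb u) x) - (\<Sum>u\<in>V. update_expectation f (Sb u) y)) / ?n"
      using xy blockD(2) by (simp add: kernel_apply_block_dynamics diff_divide_distrib)
    also have "\<dots> \<le> L * (?n - 1 + (1 + real \<Delta>) ^ k * spread) / ?n"
      using sum_update_expectation_neighbours_le[OF xy agree v _ _ rate, of L f] f n
      by (intro divide_right_mono) auto
    also have "\<dots> \<le> L * (?n - 1 + \<delta>) / ?n"
      using f \<delta> n by (intro divide_right_mono mult_left_mono add_left_mono) auto
    also have "\<dots> = (1 - (1 - \<delta>) / ?n) * L" using n by (simp add: field_simps)
    finally show "?P f x - ?P f y \<le> (1 - (1 - \<delta>) / ?n) * L" .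
  qed
qed

lemma tv_dist_block_dynamics_le:
  assumes rate: "component_rate k \<le> 1" and \<delta>: "(1 + real \<Delta>) ^ k * spread \<le> \<delta>"
    and V: "V \<noteq> {}" and x: "x \<in> \<Omega>"
  shows "tv_dist \<Omega> (mpow \<Omega> (block_dynamics V adj q lam Sb) t x) (gibbs V adj q lam)
    \<le> real (card V) * (1 - (1 - \<delta>) / real (card V)) ^ t"
proof (rule tv_dist_mpow_contraction_le[OF finite_configs block_dynamics_contraction[OF rate \<delta>] _
      gibbs_stationary[OF blockD(2) V] sum_gibbs gibbs_nonneg _ _ _ x])
  have "1 \<le> real (card V)" using V finite_V by (simp add: Suc_le_eq card_gt_0_iff)
  moreover have "0 \<le> (1 + real \<Delta>) ^ k * spread" using spread_nonneg by simp
  then have "0 \<le> \<delta>" using \<delta> by linarith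
  ultimately show "0 \<le> 1 - (1 - \<delta>) / real (card V)" by (simp add: field_simps)
qed (simp_all add: hamming_self hamming_ge_1 hamming_le_card finite_V)

end

section \<open>Mixing time\<close>

lemma discrepancy_constant_le_colour_constant:
  assumes k: "2 \<le> k" and D: "0 < D"
  shows "4 * ((1 + real D) ^ k * (real k * real k * 2 ^ k))
    \<le> 2 ^ (k + 1) * real D ^ (2 * k) * real k ^ (2 * k + 1)"
proof -
  have "(1 + real D) ^ k \<le> (2 * real D) ^ k" using D by (intro power_mono) auto
  also have "\<dots> = 2 ^ k * real D ^ k" by (rule power_mult_distrib)
  also have "\<dots> \<le> 2 ^ k * real D ^ (2 * k)"
    using D by (intro mult_left_mono power_increasing) auto
  finally have degree: "(1 + real D) ^ k \<le> 2 ^ k * real D ^ (2 * k)" .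
  have "(2 :: real) ^ (k + 1) \<le> 2 ^ (2 * k - 1)" using k by (intro power_increasing) auto
  also have "\<dots> \<le> real k ^ (2 * k - 1)" using k by (intro power_mono) auto
  finally have size: "2 ^ (k + 1) \<le> real k ^ (2 * k - 1)" .
  have "4 * ((1 + real D) ^ k * (real k * real k * 2 ^ k))
      \<le> 4 * ((2 ^ k * real D ^ (2 * k)) * (real k * real k * 2 ^ k))"
    using degree by (intro mult_left_mono mult_right_mono) auto
  also have "\<dots> = 2 ^ (k + 1) * real D ^ (2 * k) * (real k ^ 2 * 2 ^ (k + 1))"
    by (simp add: power2_eq_square mult_ac)
  also have "\<dots> \<le> 2 ^ (k + 1) * real D ^ (2 * k) * (real k ^ 2 * real k ^ (2 * k - 1))"
    using size by (intro mult_left_mono) auto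
  also have "real k ^ 2 * real k ^ (2 * k - 1) = real k ^ (2 * k + 1)"
    using k by (simp flip: power_add)
  finally show ?thesis .
qed

lemma (in potts_blocks) many_colours_small_spread:
  assumes k: "2 \<le> k" and \<Delta>: "0 < \<Delta>"
    and q: "2 ^ (k + 1) * real \<Delta> ^ (2 * k) * real k ^ (2 * k + 1)
      * lam powr (real \<Delta> - 1 + 1 / real k) \<le> real q"
  shows "component_rate k \<le> 1" and "(1 + real \<Delta>) ^ k * spread \<le> 1 / 4"
proof -
  define C where "C = 2 ^ (k + 1) * real \<Delta> ^ (2 * k) * real k ^ (2 * k + 1)"
  have "real (\<Delta> - 1) = real \<Delta> - 1" using \<Delta> by (simp add: of_nat_diff)
  then have C: "C * component_rate k \<le> 1"
    using q q_pos by (simp add: C_def component_rate_def divide_le_eq)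
  have "1 \<le> C" unfolding C_def using \<Delta> k by (intro mult_ge1_I one_le_power) auto
  then show "component_rate k \<le> 1"
    using C mult_right_mono[of 1 C "component_rate k"] component_rate_nonneg by auto
  have "4 * ((1 + real \<Delta>) ^ k * spread)
      = 4 * ((1 + real \<Delta>) ^ k * (real k * real k * 2 ^ k)) * component_rate k"
    by (simp add: spread_def)
  also have "\<dots> \<le> C * component_rate k"
    unfolding C_def using discrepancy_constant_le_colour_constant[OF k \<Delta>] component_rate_nonneg
    by (rule mult_right_mono)
  finally show "(1 + real \<Delta>) ^ k * spread \<le> 1 / 4" using C by linarith
qed

lemma geometric_decay_le:
  fixes n c \<epsilon> :: real
  assumes "0 < n" "0 < \<epsilon>" "c \<le> 1" "ln (n / \<epsilon>) \<le> real t * c"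
  shows "n * (1 - c) ^ t \<le> \<epsilon>"
proof -
  have "(1 - c) ^ t \<le> exp (- c) ^ t"
    using assms(3) exp_ge_add_one_self[of "- c"] by (intro power_mono) auto
  also have "\<dots> = exp (- (real t * c))" by (simp flip: exp_of_nat_mult)
  also have "\<dots> \<le> exp (- ln (n / \<epsilon>))" using assms(4) by simp
  also have "\<dots> = \<epsilon> / n" using assms(1,2) by (simp add: exp_minus)
  finally show ?thesis using assms(1) by (simp add: field_simps)
qed

text \<open>The mixing time is an integer, so the floor of the claimed bound has to suffice; this is where
  the rate \<open>3 / (4 n)\<close> instead of \<open>1 / (2 n)\<close> is needed.\<close>
lemma ln_le_floor_mult_rate:
  fixes n \<epsilon> :: real
  assumes n: "3 \<le> n" and \<epsilon>: "0 < \<epsilon>" "\<epsilon> < 1"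
  shows "ln (n / \<epsilon>) \<le> real (nat \<lfloor>2 * n * ln (n / \<epsilon>)\<rfloor>) * ((1 - 1 / 4) / n)"
proof -
  let ?l = "ln (n / \<epsilon>)"
  have "3 \<le> n / \<epsilon>" using n \<epsilon> by (simp add: le_divide_eq)
  then have "exp 1 \<le> n / \<epsilon>" using exp_le by linarith
  then have l: "1 \<le> ?l" using n \<epsilon> by (simp add: ln_ge_iff)
  have "n * ?l \<le> 3 / 4 * (2 * n * ?l - 1)" using mult_mono[OF n l] n by simp
  also have "2 * n * ?l - 1 \<le> real (nat \<lfloor>2 * n * ?l\<rfloor>)" by linarith
  finally show ?thesis using n by (simp add: field_simps)
qed

theorem theorem2p7:
  fixes V :: "'v set" and adj :: "'v \<Rightarrow> 'v \<Rightarrow> bool" and k q :: nat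
    and Sb :: "'v \<Rightarrow> 'v set" and lam \<epsilon> :: real
  assumes "simple_graph V adj"
    and "connected_graph V adj"
    and "2 \<le> k" and "k \<le> card V - 1"
    and "block_system V adj k Sb"
    and "lam > 1"
    and "real q \<ge> 2 ^ (k + 1) * real (max_degree V adj) ^ (2 * k) * real k ^ (2 * k + 1)
                   * lam powr (real (max_degree V adj) - 1 + 1 / real k)"
    and "0 < \<epsilon>" and "\<epsilon> < 1"
  shows "real (mixing_time (configs V q) (block_dynamics V adj q lam Sb) (gibbs V adj q lam) \<epsilon>)
           \<le> 2 * real (card V) * ln (real (card V) / \<epsilon>)"
proof -
  interpret finite_simple_graph V adj by unfold_locales (rule assms(1))
  have n: "3 \<le> real (card V)" "V \<noteq> {}" using assms(3,4) by auto
  have \<Delta>: "0 < \<Delta>" using max_degree_pos[OF assms(2)] assms(3,4) by linarith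
  have "0 < 2 ^ (k + 1) * real \<Delta> ^ (2 * k) * real k ^ (2 * k + 1) * lam powr (real \<Delta> - 1 + 1 / real k)"
    using \<Delta> assms(3,6) by simp
  then have "0 < q" using assms(7) by linarith
  then interpret potts_blocks V adj q lam k Sb by unfold_locales (use assms in auto)
  note rate_and_spread = many_colours_small_spread[OF assms(3) \<Delta> assms(7)]
  let ?t = "nat \<lfloor>2 * real (card V) * ln (real (card V) / \<epsilon>)\<rfloor>"
  have "tv_dist \<Omega> (mpow \<Omega> (block_dynamics V adj q lam Sb) ?t x) (gibbs V adj q lam) \<le> \<epsilon>" if "x \<in> \<Omega>" for x
  proof -
    have "real (card V) * (1 - (1 - 1 / 4) / real (card V)) ^ ?t \<le> \<epsilon>"
      using n assms(8,9) by (intro geometric_decay_le ln_le_floor_mult_rate) auto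
    then show ?thesis using tv_dist_block_dynamics_le[OF rate_and_spread n(2) that, of ?t] by linarith
  qed
  then have "real (mixing_time \<Omega> (block_dynamics V adj q lam Sb) (gibbs V adj q lam) \<epsilon>) \<le> real ?t"
    by (intro of_nat_mono mixing_time_leI finite_configs configs_nonempty)
  also have "\<dots> \<le> 2 * real (card V) * ln (real (card V) / \<epsilon>)"
    using n assms(8,9) by (intro of_nat_floor mult_nonneg_nonneg ln_ge_zero) (auto simp: le_divide_eq)
  finally show ?thesis .
qed

end
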